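(* Let $\mu$ be the vector of market weights and $A\in CBV([0,T],\mathbb{R}^m)$. Let $G:\mathbb{R}^d\times\mathbb{R}^m\to(0,\infty)$ be regular for the pair $(\mu,A)$, normalized so that $G(\mu(0),A(0))=1$, and suppose that: (i) there exist positive constants $\alpha,\beta$ with $0<\alpha\le G(\mu(t),A(t))\le\beta$ for all $t\in[0,T]$; (ii) $\Gamma^G$ is nondecreasing on $[0,T]$. Suppose that for some real number $T_*\in(0,T]$ $$\Gamma^G(T_* )>\beta\log\Big(\frac1\alpha\Big).$$ Then the trading strategy $\psi$ multiplicatively generated by $G$ is strong arbitrage relative to the market over every time horizon $[0,t]$ with $T_*\le t\le T$.
   Context: Partitions: $T>0$ is fixed, and $(\mathbb{T}_n)_{n\in\mathbb{N}}$ is a fixed sequence of finite partitions of $[0,T]$ (containing $0$ and $T$) with $\mathbb{T}_1\subset\mathbb{T}_2\subset\cdots$ and mesh tending to $0$. $[t_j,t_{j+1}]\in\mathbb{T}_n$ means that $t_j<t_{j+1}$ are consecutive points of $\mathbb{T}_n$; in sums over $[t_j,t_{j+1}]\in\mathbb{T}_n$ with $t_j\le t$, $t_{j+1}$ is replaced by $t$ when $j$ is the largest index with $t_j\le t$. Market weights: $S_1,\dots,S_d:[0,T]\to[0,\infty)$ ($d\ge2$) are continuous with $S_i(0)>0$ and $S_1(t)+\dots+S_d(t)>0$ for all $t$; $\mu_i(t)=S_i(t)/(S_1(t)+\dots+S_d(t))$. It is assumed that $\mu$ has pathwise quadratic covariations along $(\mathbb{T}_n)$: for all $i,k$ and $t$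 the limit $\langle\mu_i,\mu_k\rangle(t)=\lim_n\sum_{[t_j,t_{j+1}]\in\mathbb{T}_n,\,t_j\le t}(\mu_i(t_{j+1})-\mu_i(t_j))(\mu_k(t_{j+1})-\mu_k(t_j))$ exists and is real-valued and continuous in $t$. $CBV([0,T],\mathbb{R}^m)$: continuous $\mathbb{R}^m$-valued functions of bounded variation on $[0,T]$. $\mathbb{C}^{2,1}$: functions on $\mathbb{R}^{d+m}$ twice continuously differentiable in the first $d$ variables and once continuously differentiable in the last $m$ variables; $\partial_i$ denotes the derivative in the $i$-th of the first $d$ variables. Integral: for integrands $\theta=(\theta_1,\dots,\theta_d)$ below, $\int_0^t\sum_{i=1}^d\theta_i(s)\,d\mu_i(s):=\lim_{n}\sum_{[t_j,t_{j+1}]\in\mathbb{T}_n,\,t_j\le t}\sum_{i=1}^d\theta_i(t_j)(\mu_i(t_{j+1})-\mu_i(t_j))$ (the limits needed here exist by the pathwise Itô formula). Regular function: $G\in\mathbb{C}^{2,1}$ is regular for $(\mu,A)$ if $\Gamma^G(t):=G(\mu(0),A(0))-G(\mu(t),A(t))+\int_0^t\sum_i\partial_iG(\mu(s),A(s))\,d\mu_i(s)$, $0\le t\le T$, has finite variation on compact intervals of $[0,T]$. Multiplicative generation: put $\eta_i(t)=\partial_iG(\mu(t),A(t))\exp\big(\int_0^t\frac{d\Gamma^G(s)}{G(\mu(s),A(s))}\big)$ (Lebesgue–Stieltjes integral in the exponent), $V^\eta(t)=\sum_i\eta_i(t)\mu_i(t)$, $Q^\eta(t)=V^\eta(t)-V^\eta(0)-\int_0^t\sum_i\eta_i(s)\,d\mu_i(s)$,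 and $C(0)=\sum_i\partial_iG(\mu(0),A(0))\mu_i(0)-G(\mu(0),A(0))$. The trading strategy multiplicatively generated by $G$ is $\psi_i(t)=\eta_i(t)-Q^\eta(t)-C(0)$, $i=1,\dots,d$; its value is $V^\psi(t)=\sum_i\psi_i(t)\mu_i(t)$. Strong relative arbitrage: a trading strategy $\psi$ is strong arbitrage relative to the market over $[0,t]$, $t\in(0,T]$, if $V^\psi(s)\ge0$ for all $s\in[0,t]$ and $V^\psi(t)>V^\psi(0)$. *)

theory Defs
  imports "HOL-Analysis.Analysis"
begin

text \<open>
  Functions of time have type \<^typ>\<open>real \<Rightarrow> 'a\<close>; only their values on \<open>[0,T]\<close> are used.
\<close>

subsection \<open>Partitions and Foellmer integrals\<close>

definition consecutive :: "real set \<Rightarrow> (real \<times> real) set" where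
  "consecutive D = {(u, v). u \<in> D \<and> v \<in> D \<and> u < v \<and> D \<inter> {u<..<v} = {}}"

definition mesh :: "real set \<Rightarrow> real" where
  "mesh D = Max ((\<lambda>(u, v). v - u) ` consecutive D)"

definition refining_partitions :: "real \<Rightarrow> (nat \<Rightarrow> real set) \<Rightarrow> bool" where
  "refining_partitions T P \<longleftrightarrow>
     (\<forall>n. finite (P n) \<and> P n \<subseteq> {0..T} \<and> 0 \<in> P n \<and> T \<in> P n \<and> P n \<subseteq> P (Suc n)) \<and>
     (\<lambda>n. mesh (P n)) \<longlonglongrightarrow> 0"

text \<open>
  If \<open>u \<le> t\<close>, the right end point \<open>v\<close> of a partition interval \<open>[u,v]\<close> lies beyond \<open>t\<close> only when
  \<open>u\<close> is the last partition point not exceeding \<open>t\<close>. So replacing the right end point by \<open>t\<close> in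
  the last interval amounts to using \<open>min v t\<close> throughout.
\<close>

definition sum_upto :: "real set \<Rightarrow> real \<Rightarrow> (real \<Rightarrow> real \<Rightarrow> real) \<Rightarrow> real" where
  "sum_upto D t f = (\<Sum>(u, v)\<in>{(u, v) \<in> consecutive D. u \<le> t}. f u (min v t))"

definition has_quadratic_covariations ::
    "real \<Rightarrow> (nat \<Rightarrow> real set) \<Rightarrow> (real \<Rightarrow> real ^ 'd) \<Rightarrow> bool" where
  "has_quadratic_covariations T P x \<longleftrightarrow>
     (\<forall>i k. \<exists>q :: real \<Rightarrow> real. continuous_on {0..T} q \<and>
        (\<forall>t\<in>{0..T}.
           (\<lambda>n. sum_upto (P n) t (\<lambda>u v. (x v $ i - x u $ i) * (x v $ k - x u $ k)))
             \<longlonglongrightarrow> q t))"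

definition foellmer_integral ::
    "(nat \<Rightarrow> real set) \<Rightarrow> (real \<Rightarrow> real ^ 'd) \<Rightarrow> (real \<Rightarrow> real ^ 'd) \<Rightarrow> real \<Rightarrow> real" where
  "foellmer_integral P \<theta> x t =
     lim (\<lambda>n. sum_upto (P n) t (\<lambda>u v. \<Sum>i\<in>UNIV. \<theta> u $ i * (x v $ i - x u $ i)))"


subsection \<open>Functions of bounded variation and Lebesgue--Stieltjes integrals\<close>

definition variation_sum :: "(real \<Rightarrow> 'a :: real_normed_vector) \<Rightarrow> real set \<Rightarrow> real" where
  "variation_sum f D = (\<Sum>(u, v)\<in>consecutive D. norm (f v - f u))"

definition bounded_variation_on ::
    "real \<Rightarrow> real \<Rightarrow> (real \<Rightarrow> 'a :: real_normed_vector) \<Rightarrow> bool" where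
  "bounded_variation_on a b f \<longleftrightarrow> bdd_above (variation_sum f ` {D. finite D \<and> D \<subseteq> {a..b}})"

definition total_variation ::
    "real \<Rightarrow> real \<Rightarrow> (real \<Rightarrow> 'a :: real_normed_vector) \<Rightarrow> real" where
  "total_variation a b f = (SUP D\<in>{D. finite D \<and> D \<subseteq> {a..b}}. variation_sum f D)"

definition CBV :: "real \<Rightarrow> (real \<Rightarrow> 'a :: real_normed_vector) \<Rightarrow> bool" where
  "CBV T f \<longleftrightarrow> continuous_on {0..T} f \<and> bounded_variation_on 0 T f"

text \<open>
  The Lebesgue--Stieltjes integral of \<open>f\<close> over \<open>(a,b]\<close> against a right-continuous \<open>F\<close> of bounded
  variation on \<open>[a,b]\<close>, through the decomposition \<open>F = V - (V - F)\<close> into nondecreasing functions,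
  where \<open>V s\<close> is the total variation of \<open>F\<close> on \<open>[a,s]\<close>. Both are extended to the real line by
  constants outside \<open>[a,b]\<close>, as \<^const>\<open>interval_measure\<close> requires.
\<close>

definition stieltjes_integral ::
    "real \<Rightarrow> real \<Rightarrow> (real \<Rightarrow> real) \<Rightarrow> (real \<Rightarrow> real) \<Rightarrow> real" where
  "stieltjes_integral a b f F =
     (let c = (\<lambda>s. max a (min b s)); V = (\<lambda>s. total_variation a s F) in
       (LINT s:{a<..b}|interval_measure (\<lambda>s. V (c s)). f s) -
       (LINT s:{a<..b}|interval_measure (\<lambda>s. V (c s) - F (c s)). f s))"


subsection \<open>Functions of class \<open>C\<^sup>2\<^sup>,\<^sup>1\<close>\<close>

definition dir_differentiable :: "('a :: real_normed_vector \<Rightarrow> real) \<Rightarrow> 'a \<Rightarrow> bool" where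
  "dir_differentiable f v \<longleftrightarrow> (\<forall>z. (\<lambda>h. f (z + h *\<^sub>R v)) differentiable (at 0))"

definition dir_deriv :: "('a :: real_normed_vector \<Rightarrow> real) \<Rightarrow> 'a \<Rightarrow> 'a \<Rightarrow> real" where
  "dir_deriv f v z = deriv (\<lambda>h. f (z + h *\<^sub>R v)) 0"

definition C1_along :: "('a :: real_normed_vector \<Rightarrow> real) \<Rightarrow> 'a \<Rightarrow> bool" where
  "C1_along f v \<longleftrightarrow> dir_differentiable f v \<and> continuous_on UNIV (dir_deriv f v)"

definition e1 :: "'d::finite \<Rightarrow> (real ^ 'd) \<times> (real ^ 'm)" where
  "e1 i = (axis i 1, 0)"

definition e2 :: "'m::finite \<Rightarrow> (real ^ 'd) \<times> (real ^ 'm)" where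
  "e2 j = (0, axis j 1)"

definition C21 :: "((real ^ 'd) \<times> (real ^ 'm) \<Rightarrow> real) \<Rightarrow> bool" where
  "C21 G \<longleftrightarrow>
     (\<forall>i. C1_along G (e1 i)) \<and>
     (\<forall>i k. C1_along (dir_deriv G (e1 i)) (e1 k)) \<and>
     (\<forall>j. C1_along G (e2 j))"

text \<open>The vector of the partial derivatives in the first \<open>d\<close> variables.\<close>

definition grad1 :: "((real ^ 'd) \<times> (real ^ 'm) \<Rightarrow> real) \<Rightarrow> (real ^ 'd) \<times> (real ^ 'm) \<Rightarrow> real ^ 'd" where
  "grad1 G z = (\<chi> i. dir_deriv G (e1 i) z)"


subsection \<open>Market weights\<close>

definition market_prices :: "real \<Rightarrow> (real \<Rightarrow> real ^ 'd) \<Rightarrow> bool" where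
  "market_prices T S \<longleftrightarrow>
     continuous_on {0..T} S \<and>
     (\<forall>t\<in>{0..T}. \<forall>i. S t $ i \<ge> 0) \<and>
     (\<forall>i. S 0 $ i > 0) \<and>
     (\<forall>t\<in>{0..T}. (\<Sum>i\<in>UNIV. S t $ i) > 0)"

definition market_weights :: "(real \<Rightarrow> real ^ 'd) \<Rightarrow> real \<Rightarrow> real ^ 'd" where
  "market_weights S t = (\<chi> i. S t $ i / (\<Sum>k\<in>UNIV. S t $ k))"


subsection \<open>Regular functions and multiplicative generation\<close>

definition Gamma_process ::
    "(nat \<Rightarrow> real set) \<Rightarrow> ((real ^ 'd) \<times> (real ^ 'm) \<Rightarrow> real) \<Rightarrow>
     (real \<Rightarrow> real ^ 'd) \<Rightarrow> (real \<Rightarrow> real ^ 'm) \<Rightarrow> real \<Rightarrow> real" where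
  "Gamma_process P G \<mu> A t =
     G (\<mu> 0, A 0) - G (\<mu> t, A t) + foellmer_integral P (\<lambda>s. grad1 G (\<mu> s, A s)) \<mu> t"

definition regular ::
    "real \<Rightarrow> (nat \<Rightarrow> real set) \<Rightarrow> ((real ^ 'd) \<times> (real ^ 'm) \<Rightarrow> real) \<Rightarrow>
     (real \<Rightarrow> real ^ 'd) \<Rightarrow> (real \<Rightarrow> real ^ 'm) \<Rightarrow> bool" where
  "regular T P G \<mu> A \<longleftrightarrow>
     C21 G \<and> (\<forall>a b. 0 \<le> a \<and> a \<le> b \<and> b \<le> T \<longrightarrow> bounded_variation_on a b (Gamma_process P G \<mu> A))"

definition portfolio_value ::
    "(real \<Rightarrow> real ^ 'd) \<Rightarrow> (real \<Rightarrow> real ^ 'd) \<Rightarrow> real \<Rightarrow> real" where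
  "portfolio_value \<mu> \<theta> t = (\<Sum>i\<in>UNIV. \<theta> t $ i * \<mu> t $ i)"

definition self_financing_defect ::
    "(nat \<Rightarrow> real set) \<Rightarrow> (real \<Rightarrow> real ^ 'd) \<Rightarrow> (real \<Rightarrow> real ^ 'd) \<Rightarrow> real \<Rightarrow> real" where
  "self_financing_defect P \<mu> \<theta> t =
     portfolio_value \<mu> \<theta> t - portfolio_value \<mu> \<theta> 0 - foellmer_integral P \<theta> \<mu> t"

definition multiplicative_integrand ::
    "(nat \<Rightarrow> real set) \<Rightarrow> ((real ^ 'd) \<times> (real ^ 'm) \<Rightarrow> real) \<Rightarrow>
     (real \<Rightarrow> real ^ 'd) \<Rightarrow> (real \<Rightarrow> real ^ 'm) \<Rightarrow> real \<Rightarrow> real ^ 'd" where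
  "multiplicative_integrand P G \<mu> A t =
     (\<chi> i. grad1 G (\<mu> t, A t) $ i *
        exp (stieltjes_integral 0 t (\<lambda>s. 1 / G (\<mu> s, A s)) (Gamma_process P G \<mu> A)))"

definition multiplicatively_generated ::
    "(nat \<Rightarrow> real set) \<Rightarrow> ((real ^ 'd) \<times> (real ^ 'm) \<Rightarrow> real) \<Rightarrow>
     (real \<Rightarrow> real ^ 'd) \<Rightarrow> (real \<Rightarrow> real ^ 'm) \<Rightarrow> real \<Rightarrow> real ^ 'd" where
  "multiplicatively_generated P G \<mu> A t =
     (let \<eta> = multiplicative_integrand P G \<mu> A;
          C0 = (\<Sum>i\<in>UNIV. grad1 G (\<mu> 0, A 0) $ i * \<mu> 0 $ i) - G (\<mu> 0, A 0)
      in \<chi> i. \<eta> t $ i - self_financing_defect P \<mu> \<eta> t - C0)"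

definition strong_relative_arbitrage ::
    "(real \<Rightarrow> real ^ 'd) \<Rightarrow> (real \<Rightarrow> real ^ 'd) \<Rightarrow> real \<Rightarrow> bool" where
  "strong_relative_arbitrage \<mu> \<psi> t \<longleftrightarrow>
     (\<forall>s\<in>{0..t}. portfolio_value \<mu> \<psi> s \<ge> 0) \<and>
     portfolio_value \<mu> \<psi> t > portfolio_value \<mu> \<psi> 0"

end

theory Submission
  imports Defs
begin

text \<open>
  Write \<open>Y = G(\<mu>,A)\<close>, \<open>K = \<integral> d\<Gamma> / Y\<close> and \<open>E = exp K\<close>. Since the weights sum to one,
  \<open>V\<^sup>\<psi> = 1 + \<integral> \<eta> d\<mu>\<close>, and this equals \<open>Y \<cdot> E\<close>. So \<open>V\<^sup>\<psi>\<close> is positive, starts at \<open>1\<close>, and at time \<open>t\<close> it is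
  at least \<open>\<alpha> \<cdot> exp (\<Gamma> t / \<beta>) > 1\<close>.

  For \<open>Y \<cdot> E = 1 + \<integral> \<eta> d\<mu>\<close>, Taylor's formula splits an increment of \<open>Y\<close> into \<open>\<partial>G \<cdot> \<Delta>\<mu>\<close> and a remainder
  which is, up to a negligible error, a combination of the increments of \<open>A\<close> and of the products
  \<open>\<Delta>\<mu>\<^sub>i \<Delta>\<mu>\<^sub>k\<close> with continuous coefficients. Along the partitions the remainders thus form discrete
  measures of bounded mass whose distribution functions converge to the continuous function \<open>- \<Gamma>\<close>;
  in particular the Foellmer integrals exist. Weighting by \<open>E\<close> and summing by parts leaves
  \<open>\<Sum> (Y \<cdot> \<Delta>E - E \<cdot> \<Delta>\<Gamma>)\<close>, which vanishes in the limit because \<open>\<Delta>K \<approx> \<Delta>\<Gamma> / Y\<close>.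
\<close>

subsection \<open>Sums over partitions\<close>

text \<open>The half-open convention \<open>p \<le> u < q\<close> gives each point before the last
  partition point its own interval. The left end \<open>p\<close> is where integrands are later
  frozen on a coarse partition.\<close>

lemma consecutive_bracket:
  fixes u :: real
  assumes "finite D" "a \<in> D" "a \<le> u" "b \<in> D" "u < b"
  defines "p \<equiv> Max {x \<in> D. x \<le> u}" and "q \<equiv> Min {x \<in> D. u < x}"
  shows "(p, q) \<in> consecutive D" "p \<le> u" "u < q"
proof -
  have p: "p \<in> {x \<in> D. x \<le> u}"
    unfolding p_def using assms by (intro Max_in) auto
  have q: "q \<in> {x \<in> D. u < x}"
    unfolding q_def using assms by (intro Min_in) auto
  have "x \<notin> {p<..<q}" if "x \<in> D" for x
  proof (cases "x \<le> u")
    case True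
    then have "x \<le> p" unfolding p_def using assms that by (intro Max_ge) auto
    then show ?thesis by simp
  next
    case False
    then have "q \<le> x" unfolding q_def using assms that by (intro Min_le) auto
    then show ?thesis by simp
  qed
  then show "(p, q) \<in> consecutive D"
    using p q by (auto simp: consecutive_def)
  show "p \<le> u" "u < q" using p q by auto
qed

lemma consecutiveD:
  assumes "(u, v) \<in> consecutive D"
  shows "u \<in> D" "v \<in> D" "u < v" "x \<in> D \<Longrightarrow> x \<le> u \<or> v \<le> x"
  using assms by (force simp: consecutive_def)+

text \<open>No end point of either pair can lie strictly inside the other pair, which leaves no room
  for two different half-open intervals around \<open>u\<close>.\<close>

lemma consecutive_unique:
  assumes "(s, s') \<in> consecutive D" "(r, r') \<in> consecutive D" "s \<le> u" "u < s'" "r \<le> u" "u < r'"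
  shows "s = r \<and> s' = r'"
  using consecutiveD(1,2)[OF assms(1)] consecutiveD(1,2)[OF assms(2)]
    consecutiveD(4)[OF assms(1), of r] consecutiveD(4)[OF assms(1), of r']
    consecutiveD(4)[OF assms(2), of s] consecutiveD(4)[OF assms(2), of s'] assms(3-)
  by auto

lemma finite_consecutive: "finite D \<Longrightarrow> finite (consecutive D)"
  by (rule finite_subset[of _ "D \<times> D"]) (auto simp: consecutive_def)

text \<open>The step for an induction that adds points from left to right: a point beyond all others
  splits no existing gap.\<close>

lemma consecutive_insert_greatest:
  assumes "finite D" "D \<noteq> {}" "\<And>x. x \<in> D \<Longrightarrow> x < b"
  shows "consecutive (insert b D) = insert (Max D, b) (consecutive D)"
proof -
  have mx: "Max D \<in> D" "\<And>x. x \<in> D \<Longrightarrow> x \<le> Max D"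
    using assms by auto
  have "(u, v) \<in> consecutive (insert b D) \<longleftrightarrow> (u, v) \<in> insert (Max D, b) (consecutive D)" for u v
  proof
    assume L: "(u, v) \<in> consecutive (insert b D)"
    note c = consecutiveD[OF L]
    have u: "u \<in> D" using c assms(3) by (metis insertE less_asym less_irrefl)
    show "(u, v) \<in> insert (Max D, b) (consecutive D)"
    proof (cases "v = b")
      case True
      have "u = Max D" using c(4)[of "Max D"] mx u True assms(3)[OF mx(1)] by force
      then show ?thesis using True by simp
    next
      case False
      then show ?thesis using L u by (auto simp: consecutive_def)
    qed
  next
    assume "(u, v) \<in> insert (Max D, b) (consecutive D)"
    then consider "u = Max D" "v = b" | "(u, v) \<in> consecutive D" by auto
    then show "(u, v) \<in> consecutive (insert b D)"
    proof cases
      case 1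
      then show ?thesis using mx assms(3) by (force simp: consecutive_def)
    next
      case 2
      then show ?thesis using assms(3)[OF consecutiveD(2)[OF 2]] by (auto simp: consecutive_def)
    qed
  qed
  then show ?thesis by auto
qed

lemma sum_consecutive_telescope:
  fixes h :: "real \<Rightarrow> 'a :: ab_group_add"
  assumes "finite D" "D \<noteq> {}"
  shows "(\<Sum>(u, v)\<in>consecutive D. h v - h u) = h (Max D) - h (Min D)"
  using assms
proof (induction rule: finite_linorder_max_induct)
  case empty
  then show ?case by simp
next
  case (insert b D)
  show ?case
  proof (cases "D = {}")
    case True
    have "consecutive {b} = {}" by (auto simp: consecutive_def)
    then show ?thesis using True by simp
  next
    case False
    have "(Max D, b) \<notin> consecutive D"
      using insert.hyps(2) by (auto simp: consecutive_def)
    moreover have "Max (insert b D) = b"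
      using insert.hyps(1,2) by (intro Max_eqI) (auto simp: less_imp_le)
    moreover have "Min (insert b D) = Min D"
    proof (rule Min_eqI)
      show "Min D \<in> insert b D" "finite (insert b D)" using insert.hyps False by auto
      fix y assume "y \<in> insert b D"
      moreover have "Min D < b" using insert.hyps False by simp
      ultimately show "Min D \<le> y" using insert.hyps(1) by (auto simp: less_imp_le)
    qed
    ultimately show ?thesis
      using False insert finite_consecutive
      by (simp add: consecutive_insert_greatest)
  qed
qed

section \<open>Partitions of \<open>[0,T]\<close> and sums truncated at time
  \<open>t\<close>\<close>

definition partition_of :: "real \<Rightarrow> real set \<Rightarrow> bool" where
  "partition_of T D \<longleftrightarrow> finite D \<and> D \<subseteq> {0..T} \<and> 0 \<in> D \<and> T \<in> D"

text \<open>For \<open>u = t\<close> the cut right end \<open>min v t\<close> is again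
  \<open>t\<close>, so that term is \<open>f t t\<close>. What is left has positive length, which
  makes the later regroupings exact.\<close>

lemma sum_upto_strict:
  assumes "finite D" "f t t = 0"
  shows "sum_upto D t f = (\<Sum>(u, v)\<in>{(u, v) \<in> consecutive D. u < t}. f u (min v t))"
  unfolding sum_upto_def
proof (rule sum.mono_neutral_right)
  show "finite {(u, v) \<in> consecutive D. u \<le> t}"
    by (rule finite_subset[OF _ finite_consecutive[OF assms(1)]]) auto
  show "\<forall>i\<in>{(u, v) \<in> consecutive D. u \<le> t} - {(u, v) \<in> consecutive D. u < t}.
       (case i of (u, v) \<Rightarrow> f u (min v t)) = 0"
  proof -
    have "f u (min v t) = 0" if "(u, v) \<in> consecutive D" "u \<le> t" "\<not> u < t" for u v
      using that assms(2) consecutiveD(3)[OF that(1)] by (simp add: min_def)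
    then show ?thesis by fast
  qed
qed auto

text \<open>Sending \<open>(u, v)\<close> to \<open>(u, min v t)\<close> is a bijection onto the
  consecutive pairs of the partition cut at \<open>t\<close>. Telescoping and variation bounds for
  finite sets thereby apply to truncated sums.\<close>

lemma sum_upto_eq_consecutive:
  assumes D: "partition_of T D" and t: "t \<in> {0..T}" and f: "f t t = 0"
  shows "sum_upto D t f = (\<Sum>(u, v)\<in>consecutive (insert t (D \<inter> {..t})). f u v)"
proof -
  have fin: "finite D" and DT: "0 \<in> D" "T \<in> D" "D \<subseteq> {0..T}" using D by (auto simp: partition_of_def)
  let ?X = "{(u, v) \<in> consecutive D. u < t}"
  let ?g = "\<lambda>(u, v). (u, min v t)"
  have inj: "inj_on ?g ?X"
  proof (rule inj_onI, clarify)
    fix u v w assume "(u, v) \<in> consecutive D" "(u, w) \<in> consecutive D"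
    then show "u = u \<and> v = w"
      using consecutive_unique[of u v D u w u] consecutiveD(3) by blast
  qed
  have img: "?g ` ?X = consecutive (insert t (D \<inter> {..t}))"
  proof (intro set_eqI iffI)
    fix z assume "z \<in> ?g ` ?X"
    then obtain u v where z: "z = (u, min v t)" "(u, v) \<in> consecutive D" "u < t" by auto
    note c = consecutiveD[OF z(2)]
    show "z \<in> consecutive (insert t (D \<inter> {..t}))"
    proof (cases "v \<le> t")
      case True
      have "x \<notin> {u<..<v}" if "x \<in> D" for x using c(4)[of x] that by auto
      then show ?thesis using z(1,3) c(1-3) True by (force simp: consecutive_def min_def)
    next
      case False
      have "x \<notin> {u<..<t}" if "x \<in> D" for x using c(4)[OF that] False by auto
      then show ?thesis using z(1,3) c(1-3) False by (force simp: consecutive_def min_def)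
    qed
  next
    fix z assume z: "z \<in> consecutive (insert t (D \<inter> {..t}))"
    obtain u w where uw: "z = (u, w)" by (cases z)
    note c = consecutiveD[OF z[unfolded uw]]
    have ut: "u < t" "u \<in> D" using c(1-3) by auto
    \<comment> \<open>A point \<open>u < t \<le> T\<close> of \<open>D\<close> has a successor in
      \<open>D\<close>: the interval bracketing \<open>u\<close> starts at \<open>u\<close>
      itself.\<close>
    obtain v where v: "(u, v) \<in> consecutive D"
    proof -
      have "u < T" using ut t by auto
      note b = consecutive_bracket[OF fin ut(2) order_refl DT(2) this]
      have "Max {x \<in> D. x \<le> u} = u" using fin ut by (intro Max_eqI) auto
      then show thesis using b(1) that by auto
    qed
    note cv = consecutiveD[OF v]
    have "w = min v t"
    proof (cases "v \<le> t")
      case True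
      then have "w \<le> v" using c(4)[of v] cv by auto
      moreover have "v \<le> w" using cv(4)[of w] c(2,3) True by auto
      ultimately show ?thesis using True by auto
    next
      case False
      have "w = t" using c(2,3) cv(4)[of w] False by auto
      then show ?thesis using False by auto
    qed
    then show "z \<in> ?g ` ?X" using uw v ut by force
  qed
  have "sum_upto D t f = (\<Sum>z\<in>?X. (case ?g z of (u, v) \<Rightarrow> f u v))"
    unfolding sum_upto_strict[where f = f, OF fin f] by (intro sum.cong) auto
  also have "\<dots> = (\<Sum>(u, v)\<in>?g ` ?X. f u v)"
    by (simp add: sum.reindex[OF inj])
  finally show ?thesis unfolding img .
qed

lemma sum_upto_telescope:
  assumes D: "partition_of T D" and t: "t \<in> {0..T}"
  shows "sum_upto D t (\<lambda>u v. h v - h u) = h t - h 0"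
proof -
  have "Max (insert t (D \<inter> {..t})) = t" "Min (insert t (D \<inter> {..t})) = 0"
    using D t by (auto simp: partition_of_def intro!: Max_eqI Min_eqI)
  then show ?thesis
    using D by (subst sum_upto_eq_consecutive[OF D t])
      (simp_all add: sum_consecutive_telescope partition_of_def)
qed

text \<open>Because \<open>s\<close> is a partition point, no interval straddles it: those starting
  before \<open>s\<close> end by \<open>s\<close> and contribute equally to both sums.\<close>

lemma sum_upto_diff_eq:
  assumes D: "partition_of T D" and s: "s \<in> D" "s \<le> t" and m: "\<And>u. m u u = 0"
  shows "sum_upto D t m - sum_upto D s m =
    (\<Sum>(u, v)\<in>{(u, v) \<in> consecutive D. s \<le> u \<and> u < t}. m u (min v t))"
proof -
  have fin: "finite D" using D by (simp add: partition_of_def)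
  have finX: "finite {(u, v) \<in> consecutive D. Q u v}" for Q
    by (rule finite_subset[OF _ finite_consecutive[OF fin]]) auto
  have "sum_upto D t m = (\<Sum>(u, v)\<in>{(u, v) \<in> consecutive D. u < s} \<union>
      {(u, v) \<in> consecutive D. s \<le> u \<and> u < t}. m u (min v t))"
    unfolding sum_upto_strict[where f = m, OF fin m] using s by (intro sum.cong) auto
  also have "\<dots> = (\<Sum>(u, v)\<in>{(u, v) \<in> consecutive D. u < s}. m u (min v t)) +
      (\<Sum>(u, v)\<in>{(u, v) \<in> consecutive D. s \<le> u \<and> u < t}. m u (min v t))"
    by (rule sum.union_disjoint[OF finX finX]) auto
  also have "(\<Sum>(u, v)\<in>{(u, v) \<in> consecutive D. u < s}. m u (min v t)) = sum_upto D s m"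
    unfolding sum_upto_strict[where f = m, OF fin m]
  proof (intro sum.cong refl, clarify)
    fix u v assume "(u, v) \<in> consecutive D" "u < s"
    then have "v \<le> s" using consecutiveD(4)[of u v D s] s by auto
    then show "m u (min v t) = m u (min v s)" using s by (simp add: min_absorb1)
  qed
  finally show ?thesis by simp
qed

text \<open>Grouping the fine intervals by the coarse interval containing them turns a coarse sum
  into a fine one with \<open>f\<close> frozen at the coarse left end. In that form it can be
  compared term by term with the fine sum weighted by \<open>f u\<close>.\<close>

lemma sum_upto_coarsen:
  assumes D: "partition_of T D" and D': "partition_of T D'" and sub: "D \<subseteq> D'"
    and t: "t \<in> {0..T}" and m: "\<And>u. m u u = 0"
  shows "sum_upto D t (\<lambda>s s'. f s * (sum_upto D' s' m - sum_upto D' s m)) =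
    sum_upto D' t (\<lambda>u v. f (Max {x \<in> D. x \<le> u}) * m u v)"
proof -
  \<comment> \<open>\<open>?g\<close> sends a fine interval to the coarse interval containing it,
    read off from the left end.\<close>
  let ?g = "\<lambda>(u, v :: real). (Max {x \<in> D. x \<le> u}, Min {x \<in> D. u < x})"
  let ?S = "{(u, v) \<in> consecutive D'. u < t}"
  let ?R = "{(s, s') \<in> consecutive D. s < t}"
  let ?h = "\<lambda>(u, v). f (Max {x \<in> D. x \<le> u}) * m u (min v t)"
  have fin: "finite D" "finite D'" using D D' by (auto simp: partition_of_def)
  have finS: "finite ?S" "finite ?R"
    by (rule finite_subset[OF _ finite_consecutive[OF fin(2)]], force,
        rule finite_subset[OF _ finite_consecutive[OF fin(1)]], force)
  have br: "(Max {x \<in> D. x \<le> u}, Min {x \<in> D. u < x}) \<in> consecutive D"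
      "Max {x \<in> D. x \<le> u} \<le> u" "u < Min {x \<in> D. u < x}"
    if "(u, v) \<in> consecutive D'" for u v
    using consecutive_bracket[OF fin(1), of 0 u T] D D' consecutiveD[OF that]
    by (force simp: partition_of_def)+
  have g: "?g ` ?S \<subseteq> ?R"
    using br by force
  \<comment> \<open>One fibre of \<open>?g\<close>. In the coarse interval reaching beyond
    \<open>t\<close> only the mass up to \<open>t\<close> counts, hence
    \<open>min s' t\<close>.\<close>
  have block: "(\<Sum>z\<in>{z \<in> ?S. ?g z = (s, s')}. ?h z) =
      f s * (sum_upto D' (min s' t) m - sum_upto D' s m)" if R: "(s, s') \<in> ?R" for s s'
  proof -
    have R': "(s, s') \<in> consecutive D" "s < t" using R by auto
    note c = consecutiveD[OF R'(1)]
    have eq: "{z \<in> ?S. ?g z = (s, s')} = {(u, v) \<in> consecutive D'. s \<le> u \<and> u < min s' t}"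
    proof -
      have "(Max {x \<in> D. x \<le> u} = s \<and> Min {x \<in> D. u < x} = s') \<longleftrightarrow> (s \<le> u \<and> u < s')"
        if "(u, v) \<in> consecutive D'" for u v
        using consecutive_unique[OF br(1)[OF that] R'(1), of u] br(2,3)[OF that] by blast
      then show ?thesis by auto
    qed
    have "f s * (sum_upto D' (min s' t) m - sum_upto D' s m) =
      (\<Sum>(u, v)\<in>{(u, v) \<in> consecutive D'. s \<le> u \<and> u < min s' t}. f s * m u (min v (min s' t)))"
      using c R sub by (subst sum_upto_diff_eq[OF D' _ _ m]) (auto simp: sum_distrib_left case_prod_unfold)
    also have "\<dots> = (\<Sum>z\<in>{(u, v) \<in> consecutive D'. s \<le> u \<and> u < min s' t}. ?h z)"
    proof (intro sum.cong refl, clarify)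
      fix u v assume uv: "(u, v) \<in> consecutive D'" "s \<le> u" "u < min s' t"
      have "Max {x \<in> D. x \<le> u} = s"
        using consecutive_unique[OF br(1)[OF uv(1)] R'(1)] br[OF uv(1)] uv by auto
      moreover have "v \<le> s'" using consecutiveD(4)[OF uv(1), of s'] c sub uv by auto
      then have "min v (min s' t) = min v t" by auto
      ultimately show "f s * m u (min v (min s' t)) = f (Max {x \<in> D. x \<le> u}) * m u (min v t)"
        by simp
    qed
    finally show ?thesis unfolding eq by simp
  qed
  have "sum_upto D' t (\<lambda>u v. f (Max {x \<in> D. x \<le> u}) * m u v) = sum ?h ?S"
    by (subst sum_upto_strict[OF fin(2)]) (auto simp: m)
  also have "\<dots> = (\<Sum>y\<in>?R. sum ?h {z \<in> ?S. ?g z = y})"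
    by (rule sum.group[OF finS g, symmetric])
  also have "\<dots> = (\<Sum>(s, s')\<in>?R. f s * (sum_upto D' (min s' t) m - sum_upto D' s m))"
    using block by (intro sum.cong refl) (auto simp del: mem_Collect_eq)
  also have "\<dots> = sum_upto D t (\<lambda>s s'. f s * (sum_upto D' s' m - sum_upto D' s m))"
    by (subst sum_upto_strict[OF fin(1)]) auto
  finally show ?thesis by simp
qed

lemma continuous_on_Icc_norm_bound:
  fixes f :: "real \<Rightarrow> 'a :: real_normed_vector"
  assumes "continuous_on {a..b} f"
  obtains B where "\<And>t. t \<in> {a..b} \<Longrightarrow> norm (f t) \<le> B"
  using compact_imp_bounded[OF compact_continuous_image[OF assms]] unfolding bounded_iff
  by (meson compact_Icc imageI)

section \<open>Linearity, comparison and bounds for truncated sums\<close>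

lemma sum_upto_add:
  "sum_upto D t (\<lambda>u v. f u v + g u v) = sum_upto D t f + sum_upto D t g"
  by (simp add: sum_upto_def case_prod_unfold sum.distrib)

lemma sum_upto_diff:
  "sum_upto D t (\<lambda>u v. f u v - g u v) = sum_upto D t f - sum_upto D t g"
  by (simp add: sum_upto_def case_prod_unfold sum_subtractf)

lemma sum_upto_cmult: "sum_upto D t (\<lambda>u v. c * f u v) = c * sum_upto D t f"
  by (simp add: sum_upto_def case_prod_unfold sum_distrib_left)

lemma abs_sum_upto_le: "\<bar>sum_upto D t f\<bar> \<le> sum_upto D t (\<lambda>u v. \<bar>f u v\<bar>)"
  unfolding sum_upto_def using sum_abs[of "\<lambda>(u, v). f u (min v t)"]
  by (simp add: case_prod_unfold)

lemma mesh_ge: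
  assumes "finite D" "(u, v) \<in> consecutive D"
  shows "v - u \<le> mesh D"
  unfolding mesh_def using assms finite_consecutive
  by (intro Max_ge) (auto intro!: rev_image_eqI[OF assms(2)])

text \<open>Cutting at \<open>t\<close> only shortens an interval, so it suffices to compare
  \<open>f\<close> and \<open>g\<close> on pairs no longer than the mesh. This is how estimates for
  nearby times enter.\<close>

lemma sum_upto_mono:
  assumes D: "partition_of T D" and t: "t \<in> {0..T}"
    and le: "\<And>u v. u \<in> {0..T} \<Longrightarrow> v \<in> {0..T} \<Longrightarrow> u \<le> v \<Longrightarrow> v - u \<le> mesh D \<Longrightarrow> f u v \<le> g u v"
  shows "sum_upto D t f \<le> sum_upto D t g"
  unfolding sum_upto_def
proof (rule sum_mono, clarify)
  fix u v assume uv: "(u, v) \<in> consecutive D" "u \<le> t"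
  have fin: "finite D" and sub: "D \<subseteq> {0..T}" using D by (auto simp: partition_of_def)
  show "f u (min v t) \<le> g u (min v t)"
    using le[of u "min v t"] consecutiveD[OF uv(1)] sub t uv(2) mesh_ge[OF fin uv(1)] by force
qed

lemma sum_upto_cong:
  assumes D: "partition_of T D" and t: "t \<in> {0..T}"
    and eq: "\<And>u v. u \<in> {0..T} \<Longrightarrow> v \<in> {0..T} \<Longrightarrow> f u v = g u v"
  shows "sum_upto D t f = sum_upto D t g"
  using sum_upto_mono[OF D t, of f g] sum_upto_mono[OF D t, of g f] eq by (simp add: antisym)

lemma sum_upto_0:
  assumes "partition_of T D" "f 0 0 = 0"
  shows "sum_upto D 0 f = 0"
proof -
  have none: "{(u, v). (u, v) \<in> consecutive D \<and> u < 0} = {}"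
    using assms by (force simp: partition_of_def consecutive_def)
  show ?thesis
    using sum_upto_strict[of D f 0] assms unfolding none by (simp add: partition_of_def)
qed

text \<open>Intervals ending by \<open>t\<close> also occur in the sum up to \<open>T\<close>. At
  most one interval is cut at \<open>t\<close>; its weight \<open>w u t\<close> need not be
  comparable with \<open>w u v\<close> and is bounded by \<open>C\<close> instead.\<close>

lemma sum_upto_le_total:
  assumes D: "partition_of T D" and t: "t \<in> {0..T}" and w0: "\<And>u. w u u = 0" "\<And>u v. 0 \<le> w u v"
    and C: "\<And>u v. u \<in> {0..T} \<Longrightarrow> v \<in> {0..T} \<Longrightarrow> w u v \<le> C"
  shows "sum_upto D t w \<le> sum_upto D T w + C"
proof -
  have fin: "finite D" and sub: "D \<subseteq> {0..T}" using D by (auto simp: partition_of_def)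
  let ?A = "{(u, v) \<in> consecutive D. v \<le> t}" and ?B = "{(u, v) \<in> consecutive D. u < t \<and> t < v}"
  have finX: "finite {(u, v) \<in> consecutive D. Q u v}" for Q
    by (rule finite_subset[OF _ finite_consecutive[OF fin]]) auto
  have AB: "{(u, v) \<in> consecutive D. u < t} = ?A \<union> ?B"
    by (auto dest: consecutiveD(3))
  have "sum_upto D t w = (\<Sum>(u, v)\<in>?A. w u (min v t)) + (\<Sum>(u, v)\<in>?B. w u (min v t))"
    unfolding sum_upto_strict[where f = w, OF fin w0(1)] AB
    by (rule sum.union_disjoint[OF finX finX]) auto
  moreover have "(\<Sum>(u, v)\<in>?A. w u (min v t)) \<le> sum_upto D T w"
  proof -
    have "(\<Sum>(u, v)\<in>?A. w u (min v t)) = (\<Sum>(u, v)\<in>?A. w u (min v T))"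
      using t by (intro sum.cong) auto
    also have "\<dots> \<le> sum_upto D T w"
      unfolding sum_upto_def using t w0(2) finX
      by (intro sum_mono2) (auto dest: consecutiveD(3))
    finally show ?thesis .
  qed
  moreover have "(\<Sum>(u, v)\<in>?B. w u (min v t)) \<le> C"
  proof (cases "?B = {}")
    case True
    have "0 \<le> C" using C[of t t] t w0(1) by simp
    then show ?thesis unfolding True by simp
  next
    case False
    then obtain u v where uv: "(u, v) \<in> consecutive D" "u < t" "t < v" by auto
    have "?B = {(u, v)}"
      using uv by (auto dest: consecutive_unique[OF uv(1), of _ _ t])
    moreover have "w u t \<le> C" using consecutiveD(1)[OF uv(1)] sub t by (intro C) auto
    ultimately show ?thesis using uv by (simp add: min_def)
  qed
  ultimately show ?thesis by linarith
qed

subsection \<open>Limits of weighted sums along refining partitions\<close>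

locale partition_sequence =
  fixes T :: real and P :: "nat \<Rightarrow> real set"
  assumes T_pos: "0 < T" and refining: "refining_partitions T P"
begin

lemma partition_of_P: "partition_of T (P n)"
  using refining by (auto simp: refining_partitions_def partition_of_def)

lemma P_mono: "k \<le> n \<Longrightarrow> P k \<subseteq> P n"
proof (induction rule: dec_induct)
  case (step i)
  have "P i \<subseteq> P (Suc i)" using refining by (simp add: refining_partitions_def)
  then show ?case using step.IH by blast
qed simp

lemma eventually_mesh_less:
  assumes "0 < \<delta>"
  shows "\<forall>\<^sub>F n in sequentially. mesh (P n) < \<delta>"
proof -
  have "(\<lambda>n. mesh (P n)) \<longlonglongrightarrow> 0" using refining by (simp add: refining_partitions_def)
  from order_tendstoD(2)[OF this assms] show ?thesis .
qed

text \<open>The bound is uniform in time but asked for only eventually in \<open>n\<close>, since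
  estimates on short intervals need a fine mesh. It is one-sided; the concrete weights it is applied
  to are nonnegative on ordered pairs of times.\<close>

definition bounded_sums :: "(real \<Rightarrow> real \<Rightarrow> real) \<Rightarrow> bool" where
  "bounded_sums w \<longleftrightarrow> (\<exists>B. \<forall>\<^sub>F n in sequentially. \<forall>t\<in>{0..T}. sum_upto (P n) t w \<le> B)"

lemma bounded_sums_le:
  assumes "bounded_sums w"
    and "\<And>u v. u \<in> {0..T} \<Longrightarrow> v \<in> {0..T} \<Longrightarrow> u \<le> v \<Longrightarrow> w' u v \<le> w u v"
  shows "bounded_sums w'"
proof -
  obtain B where B: "\<forall>\<^sub>F n in sequentially. \<forall>t\<in>{0..T}. sum_upto (P n) t w \<le> B"
    using assms(1) by (auto simp: bounded_sums_def)
  have le: "sum_upto (P n) t w' \<le> sum_upto (P n) t w" if "t \<in> {0..T}" for n t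
    using assms(2) by (intro sum_upto_mono[OF partition_of_P that]) auto
  from B have "\<forall>\<^sub>F n in sequentially. \<forall>t\<in>{0..T}. sum_upto (P n) t w' \<le> B"
  proof eventually_elim
    case (elim n)
    show ?case
    proof
      fix t assume t: "t \<in> {0..T}"
      show "sum_upto (P n) t w' \<le> B" using le[OF t, of n] elim t by (meson order_trans)
    qed
  qed
  then show ?thesis by (auto simp: bounded_sums_def)
qed

lemma bounded_sums_add:
  assumes "bounded_sums f" "bounded_sums g"
  shows "bounded_sums (\<lambda>u v. f u v + g u v)"
proof -
  obtain B C where "\<forall>\<^sub>F n in sequentially. \<forall>t\<in>{0..T}. sum_upto (P n) t f \<le> B"
      "\<forall>\<^sub>F n in sequentially. \<forall>t\<in>{0..T}. sum_upto (P n) t g \<le> C"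
    using assms by (auto simp: bounded_sums_def)
  then have "\<forall>\<^sub>F n in sequentially. \<forall>t\<in>{0..T}. sum_upto (P n) t (\<lambda>u v. f u v + g u v) \<le> B + C"
    by eventually_elim (auto simp: sum_upto_add intro: add_mono)
  then show ?thesis by (auto simp: bounded_sums_def)
qed

lemma bounded_sums_cmult:
  assumes "bounded_sums f" "0 \<le> c"
  shows "bounded_sums (\<lambda>u v. c * f u v)"
proof -
  obtain B where "\<forall>\<^sub>F n in sequentially. \<forall>t\<in>{0..T}. sum_upto (P n) t f \<le> B"
    using assms by (auto simp: bounded_sums_def)
  then have "\<forall>\<^sub>F n in sequentially. \<forall>t\<in>{0..T}. sum_upto (P n) t (\<lambda>u v. c * f u v) \<le> c * B"
    by eventually_elim (auto simp: sum_upto_cmult intro: mult_left_mono assms)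
  then show ?thesis by (auto simp: bounded_sums_def)
qed

lemma bounded_sums_zero: "bounded_sums (\<lambda>u v. 0)"
  unfolding bounded_sums_def by (intro exI[of _ 0]) (simp add: sum_upto_def)

lemma bounded_sums_sum:
  assumes "\<And>i. i \<in> I \<Longrightarrow> bounded_sums (f i)"
  shows "bounded_sums (\<lambda>u v. \<Sum>i\<in>I. f i u v)"
  using assms by (induction I rule: infinite_finite_induct)
    (auto simp: bounded_sums_zero intro: bounded_sums_add)

text \<open>
  The increments \<open>m u v\<close> are those of a discrete signed measure on each partition: its total mass
  stays bounded and its distribution function converges pointwise to \<open>M\<close>.
\<close>

definition integrator :: "(real \<Rightarrow> real \<Rightarrow> real) \<Rightarrow> (real \<Rightarrow> real) \<Rightarrow> bool" where
  "integrator m M \<longleftrightarrow> (\<forall>u. m u u = 0) \<and> bounded_sums (\<lambda>u v. \<bar>m u v\<bar>) \<and>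
     (\<forall>t\<in>{0..T}. (\<lambda>n. sum_upto (P n) t m) \<longlonglongrightarrow> M t) \<and> continuous_on {0..T} M"

lemma integratorD:
  assumes "integrator m M"
  shows "m u u = 0" "bounded_sums (\<lambda>u v. \<bar>m u v\<bar>)"
    "t \<in> {0..T} \<Longrightarrow> (\<lambda>n. sum_upto (P n) t m) \<longlonglongrightarrow> M t" "continuous_on {0..T} M"
  using assms by (auto simp: integrator_def)

lemma integrator_add:
  assumes "integrator f F" "integrator g G"
  shows "integrator (\<lambda>u v. f u v + g u v) (\<lambda>t. F t + G t)"
  unfolding integrator_def
proof (intro conjI ballI allI)
  show "bounded_sums (\<lambda>u v. \<bar>f u v + g u v\<bar>)"
    using bounded_sums_add[OF integratorD(2)[OF assms(1)] integratorD(2)[OF assms(2)]]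
    by (rule bounded_sums_le) auto
qed (use assms in \<open>auto simp: integrator_def sum_upto_add intro: tendsto_add continuous_on_add\<close>)

lemma integrator_sum:
  assumes "\<And>i. i \<in> I \<Longrightarrow> integrator (f i) (F i)"
  shows "integrator (\<lambda>u v. \<Sum>i\<in>I. f i u v) (\<lambda>t. \<Sum>i\<in>I. F i t)"
  using assms
proof (induction I rule: infinite_finite_induct)
  case (insert i I)
  then show ?case by (simp add: integrator_add)
qed (auto simp: integrator_def bounded_sums_zero sum_upto_def)

text \<open>Once the mesh is below \<delta>, the errors sum to at most \<epsilon> times the bounded
  sums of \<open>w\<close>. As \<epsilon> is arbitrary the limits agree, and one fixed error bound
  controls the total mass of \<open>m'\<close>.\<close>

lemma integrator_perturb:
  assumes m: "integrator m M" and w: "bounded_sums w" and m0: "\<And>u. m' u u = 0"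
    and close: "\<And>\<epsilon>. 0 < \<epsilon> \<Longrightarrow> \<exists>\<delta>>0. \<forall>u\<in>{0..T}. \<forall>v\<in>{u..T}. v - u < \<delta> \<longrightarrow>
      \<bar>m' u v - m u v\<bar> \<le> \<epsilon> * w u v"
  shows "integrator m' M"
proof -
  have ev: "\<forall>\<^sub>F n in sequentially. \<forall>t\<in>{0..T}.
      sum_upto (P n) t (\<lambda>u v. \<bar>m' u v - m u v\<bar>) \<le> \<epsilon> * sum_upto (P n) t w" if \<epsilon>: "0 < \<epsilon>" for \<epsilon>
  proof -
    obtain \<delta> where \<delta>: "\<delta> > 0"
        "\<And>u v. u \<in> {0..T} \<Longrightarrow> v \<in> {u..T} \<Longrightarrow> v - u < \<delta> \<Longrightarrow> \<bar>m' u v - m u v\<bar> \<le> \<epsilon> * w u v"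
      using close[OF \<epsilon>] by blast
    show ?thesis using eventually_mesh_less[OF \<delta>(1)]
    proof eventually_elim
      case (elim n)
      then show ?case unfolding sum_upto_cmult[symmetric]
        by (intro ballI sum_upto_mono[OF partition_of_P] \<delta>(2)) auto
    qed
  qed
  obtain B0 where B0: "\<forall>\<^sub>F n in sequentially. \<forall>t\<in>{0..T}. sum_upto (P n) t w \<le> B0"
    using w by (auto simp: bounded_sums_def)
  \<comment> \<open>The maximum with \<open>1\<close> makes the bound positive, so that
    \<open>\<epsilon> / B\<close> can serve as the factor in the pointwise estimate.\<close>
  define B where "B = max B0 1"
  have B: "\<forall>\<^sub>F n in sequentially. \<forall>t\<in>{0..T}. sum_upto (P n) t w \<le> B" "0 < B"
    using B0 by (auto simp: B_def le_max_iff_disj elim: eventually_mono)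
  have ev': "\<forall>\<^sub>F n in sequentially. \<forall>t\<in>{0..T}.
      sum_upto (P n) t (\<lambda>u v. \<bar>m' u v - m u v\<bar>) \<le> \<epsilon>" if \<epsilon>: "0 < \<epsilon>" for \<epsilon>
  proof -
    have p: "0 < \<epsilon> / B" using \<epsilon> B by simp
    show ?thesis using ev[OF p] B(1)
    proof eventually_elim
      case (elim n)
      show ?case
      proof
        fix t assume t: "t \<in> {0..T}"
        have "(\<epsilon> / B) * sum_upto (P n) t w \<le> (\<epsilon> / B) * B"
          using elim t p by (intro mult_left_mono) auto
        then show "sum_upto (P n) t (\<lambda>u v. \<bar>m' u v - m u v\<bar>) \<le> \<epsilon>"
          using elim t B(2) by force
      qed
    qed
  qed
  have "(\<lambda>n. sum_upto (P n) t m') \<longlonglongrightarrow> M t" if t: "t \<in> {0..T}" for t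
  proof -
    have "(\<lambda>n. sum_upto (P n) t m' - sum_upto (P n) t m) \<longlonglongrightarrow> 0"
    proof (rule tendstoI)
      fix e :: real assume "0 < e"
      then have "0 < e / 2" by simp
      from ev'[OF this] show "\<forall>\<^sub>F n in sequentially.
          dist (sum_upto (P n) t m' - sum_upto (P n) t m) 0 < e"
      proof eventually_elim
        case (elim n)
        then show ?case
          using t \<open>0 < e\<close> abs_sum_upto_le[of "P n" t "\<lambda>u v. m' u v - m u v"]
          by (force simp: sum_upto_diff)
      qed
    qed
    from tendsto_add[OF this integratorD(3)[OF m t]] show ?thesis by simp
  qed
  moreover have "bounded_sums (\<lambda>u v. \<bar>m' u v\<bar>)"
  proof -
    have "bounded_sums (\<lambda>u v. \<bar>m' u v - m u v\<bar>)"
      using ev'[of 1] by (auto simp: bounded_sums_def)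
    from bounded_sums_add[OF this integratorD(2)[OF m]] show ?thesis
      by (rule bounded_sums_le) auto
  qed
  ultimately show ?thesis
    using m m0 by (simp add: integrator_def)
qed

text \<open>The index set no longer depends on \<open>t\<close>, so continuity in \<open>t\<close>
  can be read off term by term. Intervals beyond \<open>t\<close> contribute nothing, as both their
  ends are cut to \<open>t\<close>.\<close>

lemma sum_upto_eq_full:
  assumes "finite D"
  shows "sum_upto D t (\<lambda>u v. f u * (M v - M u)) =
    (\<Sum>(u, v)\<in>consecutive D. f u * (M (min v t) - M (min u t)))"
  unfolding sum_upto_def
proof (rule sum.mono_neutral_cong_left)
  have "f u * (M (min v t) - M (min u t)) = 0" if "(u, v) \<in> consecutive D" "\<not> u \<le> t" for u v
    using that consecutiveD(3)[OF that(1)] by (simp add: min_def)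
  then show "\<forall>i\<in>consecutive D - {(u, v). (u, v) \<in> consecutive D \<and> u \<le> t}.
      (case i of (u, v) \<Rightarrow> f u * (M (min v t) - M (min u t))) = 0"
    by fast
qed (auto simp: finite_consecutive assms min_def)

text \<open>
  Freezing \<open>f\<close> on the intervals of a coarse partition \<open>P k\<close> changes the sums along all finer
  partitions by at most the oscillation of \<open>f\<close> times the total mass; the frozen sums converge
  because the distribution functions do.
\<close>

lemma integrator_mult:
  assumes m: "integrator m M" and f: "continuous_on {0..T} f"
  obtains J where "integrator (\<lambda>u v. f u * m u v) J"
    "\<And>t. t \<in> {0..T} \<Longrightarrow> (\<lambda>n. sum_upto (P n) t (\<lambda>u v. f u * (M v - M u))) \<longlonglongrightarrow> J t"
proof -
  \<comment> \<open>\<open>a\<close> are the sums whose limit is sought; \<open>S\<close> replaces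
    the increments of \<open>m\<close> by those of the limit \<open>M\<close>.\<close>
  define a where "a n t = sum_upto (P n) t (\<lambda>u v. f u * m u v)" for n t
  define S where "S k t = sum_upto (P k) t (\<lambda>u v. f u * (M v - M u))" for k t
  obtain C0 where C0: "\<forall>\<^sub>F n in sequentially. \<forall>t\<in>{0..T}. sum_upto (P n) t (\<lambda>u v. \<bar>m u v\<bar>) \<le> C0"
    using integratorD(2)[OF m] by (auto simp: bounded_sums_def)
  define C where "C = max C0 1"
  have C: "\<forall>\<^sub>F n in sequentially. \<forall>t\<in>{0..T}. sum_upto (P n) t (\<lambda>u v. \<bar>m u v\<bar>) \<le> C" "0 < C"
    using C0 by (auto simp: C_def le_max_iff_disj elim: eventually_mono)
  have fin: "finite (P n)" and PT: "P n \<subseteq> {0..T}" "0 \<in> P n" "T \<in> P n" for n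
    using partition_of_P[of n] by (auto simp: partition_of_def)
  \<comment> \<open>The coarse index \<open>k\<close> is chosen uniformly in \<open>t\<close>, from
    the oscillation of \<open>f\<close>. The fine index \<open>n\<close> may depend on
    \<open>t\<close>, as the distribution functions are only assumed to converge pointwise.\<close>
  have key: "\<forall>\<^sub>F k in sequentially. \<forall>t\<in>{0..T}. \<forall>\<^sub>F n in sequentially. \<bar>a n t - S k t\<bar> \<le> \<epsilon>"
    if \<epsilon>: "0 < \<epsilon>" for \<epsilon>
  proof -
    have uc: "uniformly_continuous_on {0..T} f"
      using f by (simp add: compact_uniformly_continuous)
    have p: "0 < \<epsilon> / (2 * C)" using \<epsilon> C by simp
    obtain \<delta> where \<delta>: "\<delta> > 0"
        "\<And>x y. x \<in> {0..T} \<Longrightarrow> y \<in> {0..T} \<Longrightarrow> dist y x < \<delta> \<Longrightarrow> dist (f y) (f x) < \<epsilon> / (2 * C)"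
      using uc p unfolding uniformly_continuous_on_def by metis
    show ?thesis using eventually_mesh_less[OF \<delta>(1)]
    proof eventually_elim
      case (elim k)
      show ?case
      proof
        fix t assume t: "t \<in> {0..T}"
        let ?M = "\<lambda>n s. sum_upto (P n) s m"
        let ?S = "\<lambda>n. sum_upto (P k) t (\<lambda>s s'. f s * (?M n s' - ?M n s))"
        have "(\<lambda>n. f u * (?M n (min v t) - ?M n u)) \<longlonglongrightarrow> f u * (M (min v t) - M u)"
          if "(u, v) \<in> consecutive (P k)" for u v
          using consecutiveD[OF that] PT[of k] t
          by (intro tendsto_mult_left tendsto_diff integratorD(3)[OF m]) force+
        then have "?S \<longlonglongrightarrow> S k t"
          unfolding sum_upto_def[of "P k"] S_def by (intro tendsto_sum) auto
        then have ev: "\<forall>\<^sub>F n in sequentially. \<bar>?S n - S k t\<bar> < \<epsilon> / 2"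
          using tendstoD[of ?S "S k t" sequentially "\<epsilon> / 2"] \<epsilon> by (simp add: dist_real_def)
        show "\<forall>\<^sub>F n in sequentially. \<bar>a n t - S k t\<bar> \<le> \<epsilon>"
          using ev C(1) eventually_ge_at_top[of k]
        proof eventually_elim
          case (elim n)
          let ?p = "\<lambda>u. Max {x \<in> P k. x \<le> u}"
          have osc: "\<bar>f u - f (?p u)\<bar> \<le> \<epsilon> / (2 * C)" if u: "u \<in> {0..T}" for u
          \<comment> \<open>No interval of \<open>P k\<close> starts at \<open>T\<close>, so
            bracketing does not cover this point; there \<open>?p u\<close> is \<open>T\<close>
            itself.\<close>
          proof (cases "u = T")
            case True
            have "?p u = u" unfolding True using PT(1,3)[of k] fin by (intro Max_eqI) auto
            then show ?thesis using p by simp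
          next
            case False
            then have "u < T" using u by auto
            note b = consecutive_bracket[OF fin[of k] PT(2) _ PT(3) this]
            have "?p u \<in> {0..T}" "\<bar>u - ?p u\<bar> < \<delta>"
              using b u consecutiveD(1)[OF b(1)] PT(1)[of k] mesh_ge[OF fin b(1)]
                \<open>mesh (P k) < \<delta>\<close> by force+
            then show ?thesis using \<delta>(2)[of "?p u" u] u by (simp add: dist_real_def)
          qed
          have "a n t - ?S n = sum_upto (P n) t (\<lambda>u v. (f u - f (?p u)) * m u v)"
            unfolding a_def
            by (subst sum_upto_coarsen[OF partition_of_P partition_of_P P_mono[OF elim(3)] t])
              (auto simp: integratorD(1)[OF m] sum_upto_diff[symmetric] algebra_simps)
          also have "\<bar>\<dots>\<bar> \<le> sum_upto (P n) t (\<lambda>u v. \<bar>(f u - f (?p u)) * m u v\<bar>)"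
            by (rule abs_sum_upto_le)
          also have "\<dots> \<le> sum_upto (P n) t (\<lambda>u v. \<epsilon> / (2 * C) * \<bar>m u v\<bar>)"
            unfolding abs_mult by (intro sum_upto_mono[OF partition_of_P t] mult_right_mono osc) auto
          also have "\<dots> = \<epsilon> / (2 * C) * sum_upto (P n) t (\<lambda>u v. \<bar>m u v\<bar>)"
            by (rule sum_upto_cmult)
          also have "\<dots> \<le> \<epsilon> / (2 * C) * C"
            using elim(2) t p by (intro mult_left_mono) auto
          also have "\<dots> = \<epsilon> / 2" using C by simp
          finally show ?case using elim(1) by linarith
        qed
      qed
    qed
  qed
  have "convergent (\<lambda>n. a n t)" if t: "t \<in> {0..T}" for t
  proof -
    \<comment> \<open>All late terms lie close to one and the same number
      \<open>S k t\<close>.\<close>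
    have "Cauchy (\<lambda>n. a n t)"
    proof (rule metric_CauchyI)
      fix e :: real assume e: "0 < e"
      then have "0 < e / 3" by simp
      from key[OF this] obtain k where "\<forall>\<^sub>F n in sequentially. \<bar>a n t - S k t\<bar> \<le> e / 3"
        using t eventually_happens'[OF sequentially_bot] by blast
      then obtain N where N: "\<And>n. n \<ge> N \<Longrightarrow> \<bar>a n t - S k t\<bar> \<le> e / 3"
        by (auto simp: eventually_sequentially)
      show "\<exists>N. \<forall>i\<ge>N. \<forall>n\<ge>N. dist (a i t) (a n t) < e"
      proof (intro exI allI impI)
        fix i n assume "N \<le> i" "N \<le> n"
        then show "dist (a i t) (a n t) < e"
          using N[of i] N[of n] e unfolding dist_real_def by linarith
      qed
    qed
    then show ?thesis by (simp add: Cauchy_convergent_iff)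
  qed
  then have "\<forall>t\<in>{0..T}. \<exists>l. (\<lambda>n. a n t) \<longlonglongrightarrow> l" by (simp add: convergent_def)
  from bchoice[OF this] obtain J where J: "\<And>t. t \<in> {0..T} \<Longrightarrow> (\<lambda>n. a n t) \<longlonglongrightarrow> J t"
    by blast
  \<comment> \<open>Letting \<open>n\<close> tend to infinity removes the index that depended on
    \<open>t\<close>. The uniform convergence of \<open>S k\<close> to \<open>J\<close> yields both
    the continuity of \<open>J\<close> and the second limit in the conclusion.\<close>
  have unif: "\<forall>\<^sub>F k in sequentially. \<forall>t\<in>{0..T}. \<bar>J t - S k t\<bar> \<le> \<epsilon>" if "0 < \<epsilon>" for \<epsilon>
    using key[OF that]
  proof eventually_elim
    case (elim k)
    show ?case
    proof
      fix t assume t: "t \<in> {0..T}"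
      have "(\<lambda>n. \<bar>a n t - S k t\<bar>) \<longlonglongrightarrow> \<bar>J t - S k t\<bar>"
        by (intro tendsto_intros J t)
      then show "\<bar>J t - S k t\<bar> \<le> \<epsilon>"
        using elim t by (intro tendsto_upperbound) auto
    qed
  qed
  have ul: "uniform_limit {0..T} S J sequentially"
  proof (rule uniform_limitI)
    fix e :: real assume "0 < e"
    then have "0 < e / 2" by simp
    from unif[OF this] show "\<forall>\<^sub>F k in sequentially. \<forall>t\<in>{0..T}. dist (S k t) (J t) < e"
      by eventually_elim (use \<open>0 < e\<close> in \<open>force simp: dist_real_def abs_minus_commute\<close>)
  qed
  have contS: "continuous_on {0..T} (S k)" for k
    unfolding S_def sum_upto_eq_full[OF fin] case_prod_unfold
  proof (intro continuous_intros continuous_on_compose2[OF integratorD(4)[OF m]])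
    fix z assume "z \<in> consecutive (P k)"
    then have "fst z \<in> {0..T}" "snd z \<in> {0..T}"
      using PT(1)[of k] consecutiveD(1,2)[of "fst z" "snd z" "P k"] by (metis prod.collapse subsetD)+
    then show "(\<lambda>x. min (snd z) x) ` {0..T} \<subseteq> {0..T}" "(\<lambda>x. min (fst z) x) ` {0..T} \<subseteq> {0..T}"
      by auto
  qed
  show thesis
  proof (rule that)
    have "continuous_on {0..T} J"
      by (rule uniform_limit_theorem[OF _ ul]) (simp_all add: contS)
    moreover have "bounded_sums (\<lambda>u v. \<bar>f u * m u v\<bar>)"
    proof -
      obtain b where b: "\<And>x. x \<in> {0..T} \<Longrightarrow> \<bar>f x\<bar> \<le> b"
        using continuous_on_Icc_norm_bound[OF f] unfolding real_norm_def by blast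
      have "0 \<le> b" using b[of 0] T_pos by force
      from bounded_sums_cmult[OF integratorD(2)[OF m] this] show ?thesis
        by (rule bounded_sums_le) (auto simp: abs_mult intro!: mult_right_mono b)
    qed
    ultimately show "integrator (\<lambda>u v. f u * m u v) J"
      using J integratorD(1)[OF m] by (simp add: integrator_def a_def)
    show "(\<lambda>n. sum_upto (P n) t (\<lambda>u v. f u * (M v - M u))) \<longlonglongrightarrow> J t" if "t \<in> {0..T}" for t
      using tendsto_uniform_limitI[OF ul that] by (simp add: S_def)
  qed
qed

end

subsection \<open>Taylor expansion of functions of class \<open>C\<^sup>2\<^sup>,\<^sup>1\<close>\<close>

lemma has_derivative_along:
  assumes "dir_differentiable f v"
  shows "((\<lambda>s. f (z + s *\<^sub>R v)) has_real_derivative dir_deriv f v (z + s *\<^sub>R v)) (at s)"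
proof -
  have "((\<lambda>h. f (z + s *\<^sub>R v + h *\<^sub>R v)) has_real_derivative dir_deriv f v (z + s *\<^sub>R v)) (at 0)"
    using assms unfolding dir_differentiable_def dir_deriv_def
    by (metis DERIV_deriv_iff_real_differentiable)
  then have "((\<lambda>h. f (z + (h + s) *\<^sub>R v)) has_real_derivative dir_deriv f v (z + s *\<^sub>R v)) (at 0)"
    by (simp add: scaleR_add_left ac_simps)
  then show ?thesis
    using DERIV_shift[of "\<lambda>h. f (z + h *\<^sub>R v)" _ 0 s] by simp
qed

lemma C1_alongI:
  assumes "\<And>z. ((\<lambda>h. f (z + h *\<^sub>R v)) has_real_derivative f' z) (at 0)" "continuous_on UNIV f'"
  shows "C1_along f v" "dir_deriv f v z = f' z"
proof -
  have eq: "dir_deriv f v = f'"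
    unfolding dir_deriv_def using assms(1) DERIV_imp_deriv by blast
  then show "dir_deriv f v z = f' z" by simp
  show "C1_along f v"
    using assms eq unfolding C1_along_def dir_differentiable_def
    by (auto simp: real_differentiable_def)
qed

lemma C1_along_scaleR:
  assumes "C1_along f v"
  shows "C1_along f (c *\<^sub>R v)" "dir_deriv f (c *\<^sub>R v) z = c * dir_deriv f v z"
proof -
  have "((\<lambda>h. f (z + h *\<^sub>R c *\<^sub>R v)) has_real_derivative c * dir_deriv f v z) (at 0)" for z
  proof -
    have "((\<lambda>h. f (z + (h * c) *\<^sub>R v)) has_real_derivative dir_deriv f v (z + (0 * c) *\<^sub>R v) * c) (at 0)"
    proof (rule DERIV_chain2[where f = "\<lambda>s. f (z + s *\<^sub>R v)"])
      show "((\<lambda>h. h * c) has_real_derivative c) (at 0)" by (auto intro!: derivative_eq_intros)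
    qed (use assms has_derivative_along[of f v z 0] in \<open>simp add: C1_along_def\<close>)
    then show ?thesis by (simp add: mult.commute)
  qed
  moreover have "continuous_on UNIV (\<lambda>z. c * dir_deriv f v z)"
    using assms by (auto simp: C1_along_def intro: continuous_intros)
  ultimately show "C1_along f (c *\<^sub>R v)" "dir_deriv f (c *\<^sub>R v) z = c * dir_deriv f v z"
    by (rule C1_alongI)+
qed

lemma C1_along_mvt:
  assumes "C1_along f v"
  shows "\<exists>\<xi>\<in>{0..1}. f (z + v) - f z = dir_deriv f v (z + \<xi> *\<^sub>R v)"
proof -
  have "\<exists>\<xi>>0. \<xi> < 1 \<and> f (z + 1 *\<^sub>R v) - f (z + 0 *\<^sub>R v) = (1 - 0) * dir_deriv f v (z + \<xi> *\<^sub>R v)"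
    using assms by (intro MVT2 has_derivative_along) (auto simp: C1_along_def)
  then show ?thesis by (auto intro: less_imp_le)
qed

text \<open>The mean value theorem along \<open>w\<close>, started at
  \<open>z + h *\<^sub>R v\<close>, gives the derivative along \<open>w\<close> at a point that
  tends to \<open>z\<close> with \<open>h\<close>. Continuity of that derivative then makes the
  difference quotients add up in the limit.\<close>

lemma C1_along_add:
  assumes v: "C1_along f v" and w: "C1_along f w"
  shows "C1_along f (v + w)" "dir_deriv f (v + w) z = dir_deriv f v z + dir_deriv f w z"
proof -
  have "((\<lambda>h. f (z + h *\<^sub>R (v + w))) has_real_derivative dir_deriv f v z + dir_deriv f w z) (at 0)" for z
  proof -
    have "\<exists>\<xi>\<in>{0..1}. f (z + h *\<^sub>R v + h *\<^sub>R w) - f (z + h *\<^sub>R v) =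
        h * dir_deriv f w (z + h *\<^sub>R v + \<xi> *\<^sub>R h *\<^sub>R w)" for h
      using C1_along_mvt[OF C1_along_scaleR(1)[OF w], of "z + h *\<^sub>R v" h]
      by (simp add: C1_along_scaleR(2)[OF w])
    then obtain \<xi> where \<xi>: "\<And>h. \<xi> h \<in> {0..1}"
        "\<And>h. f (z + h *\<^sub>R v + h *\<^sub>R w) - f (z + h *\<^sub>R v) =
          h * dir_deriv f w (z + h *\<^sub>R v + \<xi> h *\<^sub>R h *\<^sub>R w)"
      by metis
    have lim0: "((\<lambda>h. \<xi> h * h) \<longlongrightarrow> 0) (at 0)"
    proof (rule Lim_null_comparison[OF always_eventually])
      show "\<forall>h. norm (\<xi> h * h) \<le> \<bar>h\<bar>"
        using \<xi>(1) by (auto simp: abs_mult intro!: mult_left_le_one_le)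
      show "((\<lambda>h::real. \<bar>h\<bar>) \<longlongrightarrow> 0) (at 0)" by (auto intro: tendsto_eq_intros)
    qed
    have "((\<lambda>h. z + h *\<^sub>R v + (\<xi> h * h) *\<^sub>R w) \<longlongrightarrow> z + 0 *\<^sub>R v + 0 *\<^sub>R w) (at 0)"
      by (intro tendsto_intros lim0)
    then have "((\<lambda>h. z + h *\<^sub>R v + \<xi> h *\<^sub>R h *\<^sub>R w) \<longlongrightarrow> z) (at 0)" by simp
    moreover have "isCont (dir_deriv f w) z"
      using w by (simp add: C1_along_def continuous_on_eq_continuous_at)
    ultimately have "((\<lambda>h. dir_deriv f w (z + h *\<^sub>R v + \<xi> h *\<^sub>R h *\<^sub>R w)) \<longlongrightarrow> dir_deriv f w z) (at 0)"
      by (rule isCont_tendsto_compose[rotated])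
    moreover have "((\<lambda>h. (f (z + h *\<^sub>R v) - f z) / h) \<longlongrightarrow> dir_deriv f v z) (at 0)"
      using has_derivative_along[of f v z 0] v by (simp add: C1_along_def DERIV_def)
    ultimately have "((\<lambda>h. (f (z + h *\<^sub>R v) - f z) / h + dir_deriv f w (z + h *\<^sub>R v + \<xi> h *\<^sub>R h *\<^sub>R w))
        \<longlongrightarrow> dir_deriv f v z + dir_deriv f w z) (at 0)"
      by (rule tendsto_add[rotated])
    moreover have "\<forall>\<^sub>F h in at 0. (f (z + h *\<^sub>R v) - f z) / h +
        dir_deriv f w (z + h *\<^sub>R v + \<xi> h *\<^sub>R h *\<^sub>R w) = (f (z + h *\<^sub>R (v + w)) - f z) / h"
      using eventually_neq_at_within[of 0 0 UNIV]
    proof eventually_elim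
      case (elim h)
      have "dir_deriv f w (z + h *\<^sub>R v + \<xi> h *\<^sub>R h *\<^sub>R w) =
          (f (z + h *\<^sub>R v + h *\<^sub>R w) - f (z + h *\<^sub>R v)) / h"
        using \<xi>(2)[of h] elim by simp
      then show ?case using elim
        by (simp add: scaleR_add_right add.assoc diff_divide_distrib)
    qed
    ultimately show ?thesis
      by (simp add: DERIV_def tendsto_cong)
  qed
  moreover have "continuous_on UNIV (\<lambda>z. dir_deriv f v z + dir_deriv f w z)"
    using v w by (auto simp: C1_along_def intro: continuous_intros)
  ultimately show "C1_along f (v + w)" "dir_deriv f (v + w) z = dir_deriv f v z + dir_deriv f w z"
    by (rule C1_alongI)+
qed

lemma C1_along_sum:
  assumes "\<And>i. i \<in> I \<Longrightarrow> C1_along f (b i)" "finite I"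
  shows "C1_along f (\<Sum>i\<in>I. c i *\<^sub>R b i) \<and>
    (\<forall>z. dir_deriv f (\<Sum>i\<in>I. c i *\<^sub>R b i) z = (\<Sum>i\<in>I. c i * dir_deriv f (b i) z))"
  using assms(2,1)
proof (induction I)
  case empty
  have "((\<lambda>h. f (z + h *\<^sub>R 0)) has_real_derivative 0) (at 0)" for z by simp
  from C1_alongI[of f 0 "\<lambda>_. 0", OF this] show ?case by simp
next
  case (insert i I)
  then have IH: "C1_along f (\<Sum>i\<in>I. c i *\<^sub>R b i)"
      "\<And>z. dir_deriv f (\<Sum>i\<in>I. c i *\<^sub>R b i) z = (\<Sum>i\<in>I. c i * dir_deriv f (b i) z)"
    and i: "C1_along f (b i)" by auto
  show ?case
    using insert.hyps C1_along_add[OF C1_along_scaleR(1)[OF i] IH(1)]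
    by (simp add: IH(2) C1_along_scaleR(2)[OF i])
qed

lemma C1_along_function_sum:
  assumes "\<And>i. i \<in> I \<Longrightarrow> C1_along (f i) v"
  shows "C1_along (\<lambda>z. \<Sum>i\<in>I. c i * f i z) v"
    "dir_deriv (\<lambda>z. \<Sum>i\<in>I. c i * f i z) v z = (\<Sum>i\<in>I. c i * dir_deriv (f i) v z)"
proof -
  have "((\<lambda>h. \<Sum>i\<in>I. c i * f i (z + h *\<^sub>R v)) has_real_derivative (\<Sum>i\<in>I. c i * dir_deriv (f i) v z)) (at 0)" for z
    using has_derivative_along[of _ v z 0] assms
    by (intro DERIV_sum DERIV_cmult) (auto simp: C1_along_def)
  moreover have "continuous_on UNIV (\<lambda>z. \<Sum>i\<in>I. c i * dir_deriv (f i) v z)"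
    using assms by (auto simp: C1_along_def intro!: continuous_intros)
  ultimately show "C1_along (\<lambda>z. \<Sum>i\<in>I. c i * f i z) v"
    "dir_deriv (\<lambda>z. \<Sum>i\<in>I. c i * f i z) v z = (\<Sum>i\<in>I. c i * dir_deriv (f i) v z)"
    by (rule C1_alongI)+
qed

lemma C2_along_taylor:
  assumes "C1_along f v" "C1_along (dir_deriv f v) v"
  shows "\<exists>\<xi>\<in>{0..1}. f (z + v) - f z - dir_deriv f v z =
    dir_deriv (dir_deriv f v) v (z + \<xi> *\<^sub>R v) / 2"
proof -
  \<comment> \<open>\<open>d n\<close> is the \<open>n\<close>-fold derivative along
    \<open>v\<close>; Maclaurin's formula of order two is applied to \<open>f\<close> on the segment
    from \<open>z\<close> to \<open>z + v\<close>.\<close>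
  define d where "d n = ((\<lambda>g. dir_deriv g v) ^^ n) f" for n :: nat
  have "\<exists>t>0. t < 1 \<and> f (z + 1 *\<^sub>R v) =
      (\<Sum>m<2. d m (z + 0 *\<^sub>R v) / fact m * 1 ^ m) + d 2 (z + t *\<^sub>R v) / fact 2 * 1 ^ 2"
  proof (rule Maclaurin[where diff = "\<lambda>n t. d n (z + t *\<^sub>R v)"])
    show "\<forall>m t. m < 2 \<and> 0 \<le> t \<and> t \<le> 1 \<longrightarrow>
        ((\<lambda>t. d m (z + t *\<^sub>R v)) has_real_derivative d (Suc m) (z + t *\<^sub>R v)) (at t)"
      using assms by (auto simp: d_def less_2_cases_iff C1_along_def intro: has_derivative_along)
  qed (auto simp: d_def)
  then obtain t where "0 < t" "t < 1" "f (z + v) = f z + dir_deriv f v z + dir_deriv (dir_deriv f v) v (z + t *\<^sub>R v) / 2"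
    by (auto simp: d_def numeral_2_eq_2)
  then show ?thesis by (intro bexI[of _ t]) auto
qed

lemma sum_e1: "(\<Sum>i\<in>UNIV. h $ i *\<^sub>R e1 i) = (h, 0 :: real ^ 'm)"
proof -
  have "(\<Sum>i\<in>UNIV. h $ i *\<^sub>R axis i 1) = h"
    by (simp add: vec_eq_iff axis_def if_distrib[of "\<lambda>x. _ * x"] cong: if_cong)
  then show ?thesis by (simp add: prod_eq_iff fst_sum snd_sum e1_def)
qed

lemma sum_e2: "(\<Sum>j\<in>UNIV. k $ j *\<^sub>R e2 j) = (0 :: real ^ 'd, k)"
proof -
  have "(\<Sum>i\<in>UNIV. k $ i *\<^sub>R axis i 1) = k"
    by (simp add: vec_eq_iff axis_def if_distrib[of "\<lambda>x. _ * x"] cong: if_cong)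
  then show ?thesis by (simp add: prod_eq_iff fst_sum snd_sum e2_def)
qed

text \<open>The first and second derivatives along \<open>(h, 0)\<close> expand in the directions
  \<open>e1 i\<close>, so the one-dimensional Taylor formula yields a quadratic form in
  \<open>h\<close> at one common intermediate point.\<close>

lemma C21_taylor1:
  fixes G :: "(real ^ 'd) \<times> (real ^ 'm) \<Rightarrow> real"
  assumes G: "C21 G"
  shows "\<exists>\<xi>\<in>{0..1}. G (x + h, a) - G (x, a) - (\<Sum>i\<in>UNIV. grad1 G (x, a) $ i * h $ i) =
    (\<Sum>i\<in>UNIV. \<Sum>k\<in>UNIV. dir_deriv (dir_deriv G (e1 i)) (e1 k) (x + \<xi> *\<^sub>R h, a) / 2 * (h $ i * h $ k))"
proof -
  let ?v = "(h, 0 :: real ^ 'm)"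
  have c1: "C1_along G (e1 i)" "C1_along (dir_deriv G (e1 i)) (e1 k)" for i k
    using G by (auto simp: C21_def)
  have 1: "C1_along G ?v" "dir_deriv G ?v = (\<lambda>z. \<Sum>i\<in>UNIV. h $ i * dir_deriv G (e1 i) z)"
    using C1_along_sum[of UNIV G e1 "\<lambda>i. h $ i"] c1 by (auto simp: sum_e1)
  have 2: "C1_along (dir_deriv G (e1 i)) ?v"
      "dir_deriv (dir_deriv G (e1 i)) ?v z = (\<Sum>k\<in>UNIV. h $ k * dir_deriv (dir_deriv G (e1 i)) (e1 k) z)" for i z
    using C1_along_sum[of UNIV "dir_deriv G (e1 i)" e1 "\<lambda>i. h $ i"] c1
    by (cases z; simp add: sum_e1)+
  have 3: "C1_along (dir_deriv G ?v) ?v" "dir_deriv (dir_deriv G ?v) ?v z =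
      (\<Sum>i\<in>UNIV. h $ i * (\<Sum>k\<in>UNIV. h $ k * dir_deriv (dir_deriv G (e1 i)) (e1 k) z))" for z
    unfolding 1(2) using C1_along_function_sum[of UNIV "\<lambda>i. dir_deriv G (e1 i)" ?v] 2 by auto
  from C2_along_taylor[OF 1(1) 3(1), of "(x, a)", unfolded 3(2), unfolded 1(2)]
  show ?thesis
    by (simp add: grad1_def sum_distrib_left sum_divide_distrib mult.assoc mult.commute mult.left_commute)
qed

lemma C21_taylor2:
  fixes G :: "(real ^ 'd) \<times> (real ^ 'm) \<Rightarrow> real"
  assumes G: "C21 G"
  shows "\<exists>\<xi>\<in>{0..1}. G (x, a + k) - G (x, a) = (\<Sum>j\<in>UNIV. dir_deriv G (e2 j) (x, a + \<xi> *\<^sub>R k) * k $ j)"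
proof -
  let ?v = "(0 :: real ^ 'd, k)"
  have 1: "C1_along G ?v" "dir_deriv G ?v = (\<lambda>z. \<Sum>i\<in>UNIV. k $ i * dir_deriv G (e2 i) z)"
    using C1_along_sum[of UNIV G e2 "\<lambda>i. k $ i"] G by (auto simp: sum_e2 C21_def)
  from C1_along_mvt[OF 1(1), of "(x, a)"] show ?thesis
    by (simp add: 1(2) mult.commute)
qed

text \<open>By the mean value theorem the increment over \<open>w\<close> is a linear form in
  \<open>w\<close>. Its coefficients are partial derivatives at a point between \<open>z\<close> and
  \<open>z + w\<close>; they converge as \<open>w\<close> tends to zero, so the increment
  vanishes.\<close>

lemma C21_continuous:
  fixes G :: "(real ^ 'd) \<times> (real ^ 'm) \<Rightarrow> real"
  assumes G: "C21 G"
  shows "continuous_on UNIV G"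
  unfolding continuous_on_eq_continuous_at[OF open_UNIV]
proof
  fix z
  have along: "C1_along G w" "dir_deriv G w y = (\<Sum>i\<in>UNIV. fst w $ i * dir_deriv G (e1 i) y) +
      (\<Sum>j\<in>UNIV. snd w $ j * dir_deriv G (e2 j) y)" for w y
  proof -
    have w: "w = (fst w, 0) + (0, snd w)" by simp
    have 1: "C1_along G (fst w, 0)" "\<forall>y. dir_deriv G (fst w, 0) y = (\<Sum>i\<in>UNIV. fst w $ i * dir_deriv G (e1 i) y)"
      using C1_along_sum[of UNIV G e1 "\<lambda>i. fst w $ i"] G unfolding sum_e1 by (auto simp: C21_def)
    have 2: "C1_along G (0, snd w)" "\<forall>y. dir_deriv G (0, snd w) y = (\<Sum>j\<in>UNIV. snd w $ j * dir_deriv G (e2 j) y)"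
      using C1_along_sum[of UNIV G e2 "\<lambda>j. snd w $ j"] G unfolding sum_e2 by (auto simp: C21_def)
    show "C1_along G w" "dir_deriv G w y = (\<Sum>i\<in>UNIV. fst w $ i * dir_deriv G (e1 i) y) +
      (\<Sum>j\<in>UNIV. snd w $ j * dir_deriv G (e2 j) y)"
      by (subst w, rule C1_along_add[OF 1(1) 2(1)], subst w, subst C1_along_add(2)[OF 1(1) 2(1)])
        (simp add: 1(2) 2(2))
  qed
  have "\<exists>\<xi>\<in>{0..1}. G (z + w) - G z = dir_deriv G w (z + \<xi> *\<^sub>R w)" for w
    by (rule C1_along_mvt[OF along(1)])
  then obtain \<xi> where \<xi>: "\<And>w. \<xi> w \<in> {0..1}" "\<And>w. G (z + w) - G z = dir_deriv G w (z + \<xi> w *\<^sub>R w)"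
    by metis
  have lim0: "((\<lambda>w. \<xi> w *\<^sub>R w) \<longlongrightarrow> 0) (at 0)"
  proof (rule Lim_null_comparison[OF always_eventually])
    show "\<forall>w. norm (\<xi> w *\<^sub>R w) \<le> norm w"
      using \<xi>(1) by (auto intro!: mult_left_le_one_le)
    show "((\<lambda>w :: (real ^ 'd) \<times> (real ^ 'm). norm w) \<longlongrightarrow> 0) (at 0)" by (auto intro: tendsto_eq_intros)
  qed
  then have lim: "((\<lambda>w. z + \<xi> w *\<^sub>R w) \<longlongrightarrow> z) (at 0)"
    using tendsto_add[OF tendsto_const lim0, of z] by simp
  have cont: "isCont (dir_deriv G (e1 i)) z" "isCont (dir_deriv G (e2 j)) z" for i j
    using G unfolding C21_def C1_along_def continuous_on_eq_continuous_at[OF open_UNIV] by blast+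
  have incr: "G (z + w) = G z + ((\<Sum>i\<in>UNIV. fst w $ i * dir_deriv G (e1 i) (z + \<xi> w *\<^sub>R w)) +
      (\<Sum>j\<in>UNIV. snd w $ j * dir_deriv G (e2 j) (z + \<xi> w *\<^sub>R w)))" for w
    using \<xi>(2)[of w] along(2)[of w "z + \<xi> w *\<^sub>R w"] by linarith
  have "((\<lambda>w. G (z + w)) \<longlongrightarrow>
      G z + ((\<Sum>i\<in>UNIV. fst (0 :: (real ^ 'd) \<times> (real ^ 'm)) $ i * dir_deriv G (e1 i) z) +
      (\<Sum>j\<in>UNIV. snd (0 :: (real ^ 'd) \<times> (real ^ 'm)) $ j * dir_deriv G (e2 j) z))) (at 0)"
    unfolding incr
    by (intro tendsto_intros isCont_tendsto_compose[OF cont(1) lim] isCont_tendsto_compose[OF cont(2) lim])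
  then show "isCont G z"
    by (simp add: isCont_iff)
qed

text \<open>The part of an increment of \<open>G\<close> along the path that the Foellmer sum of the
  gradient misses; its sums turn out to converge to \<open>- \<Gamma>\<close>.\<close>

definition remainder ::
    "((real ^ 'd) \<times> (real ^ 'm) \<Rightarrow> real) \<Rightarrow> (real \<Rightarrow> real ^ 'd) \<Rightarrow> (real \<Rightarrow> real ^ 'm) \<Rightarrow> real \<Rightarrow> real \<Rightarrow> real" where
  "remainder G x A u v = G (x v, A v) - G (x u, A u) -
     (\<Sum>i\<in>UNIV. grad1 G (x u, A u) $ i * (x v $ i - x u $ i))"

text \<open>First order in \<open>A\<close>, second order in \<open>x\<close>. The coefficients sit
  at the left end point, so each term is a continuous function of time multiplied by an increment or
  a product of increments.\<close>

definition main_part ::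
    "((real ^ 'd) \<times> (real ^ 'm) \<Rightarrow> real) \<Rightarrow> (real \<Rightarrow> real ^ 'd) \<Rightarrow> (real \<Rightarrow> real ^ 'm) \<Rightarrow> real \<Rightarrow> real \<Rightarrow> real" where
  "main_part G x A u v = (\<Sum>j\<in>UNIV. dir_deriv G (e2 j) (x u, A u) * (A v $ j - A u $ j)) +
     (\<Sum>i\<in>UNIV. \<Sum>k\<in>UNIV. dir_deriv (dir_deriv G (e1 i)) (e1 k) (x u, A u) / 2 *
        ((x v $ i - x u $ i) * (x v $ k - x u $ k)))"

text \<open>The path moves in two stages, first in \<open>x\<close> with \<open>A u\<close> kept,
  then in \<open>A\<close> at \<open>x v\<close>. Taylor's formula gives the coefficients of
  \<open>main_part\<close> at shifted points, and uniform continuity of the derivatives makes the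
  shift cost at most \<epsilon>.\<close>

lemma remainder_main_part:
  fixes G :: "(real ^ 'd) \<times> (real ^ 'm) \<Rightarrow> real"
  assumes G: "C21 G" and x: "continuous_on {0..T} x" and A: "continuous_on {0..T} A" and \<epsilon>: "0 < \<epsilon>"
  shows "\<exists>\<delta>>0. \<forall>u\<in>{0..T}. \<forall>v\<in>{u..T}. v - u < \<delta> \<longrightarrow>
    \<bar>remainder G x A u v - main_part G x A u v\<bar> \<le>
      \<epsilon> * ((\<Sum>j\<in>UNIV. \<bar>A v $ j - A u $ j\<bar>) +
        (\<Sum>i\<in>UNIV. \<Sum>k\<in>UNIV. \<bar>(x v $ i - x u $ i) * (x v $ k - x u $ k)\<bar>))"
proof -
  define H where "H i k = dir_deriv (dir_deriv G (e1 i)) (e1 k)" for i k :: 'd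
  define g where "g j = dir_deriv G (e2 j)" for j :: 'm
  obtain B1 where B1: "\<And>t. t \<in> {0..T} \<Longrightarrow> norm (x t) \<le> B1"
    using continuous_on_Icc_norm_bound[OF x] by blast
  obtain B2 where B2: "\<And>t. t \<in> {0..T} \<Longrightarrow> norm (A t) \<le> B2"
    using continuous_on_Icc_norm_bound[OF A] by blast
  \<comment> \<open>A product of balls is convex, so it contains the intermediate points of Taylor's
    formula, which need not lie on the path.\<close>
  define K where "K = cball (0 :: real ^ 'd) B1 \<times> cball (0 :: real ^ 'm) B2"
  have "compact K" by (simp add: K_def compact_Times)
  have cont: "continuous_on K (\<lambda>z. \<chi> j. g j z)" "continuous_on K (\<lambda>z. \<chi> i k. H i k z)"
    using G by (auto simp: C21_def C1_along_def g_def H_def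
      intro!: continuous_on_vec_lambda intro: continuous_on_subset[of UNIV])
  have uc: "uniformly_continuous_on K (\<lambda>z. \<chi> j. g j z)" "uniformly_continuous_on K (\<lambda>z. \<chi> i k. H i k z)"
    using cont \<open>compact K\<close> by (auto intro: compact_uniformly_continuous)
  obtain \<delta>1 where \<delta>1: "\<delta>1 > 0"
      "\<And>z w. z \<in> K \<Longrightarrow> w \<in> K \<Longrightarrow> dist w z < \<delta>1 \<Longrightarrow> dist (\<chi> j. g j w) (\<chi> j. g j z) < \<epsilon>"
    using uc(1) \<epsilon> unfolding uniformly_continuous_on_def by metis
  obtain \<delta>2 where \<delta>2: "\<delta>2 > 0"
      "\<And>z w. z \<in> K \<Longrightarrow> w \<in> K \<Longrightarrow> dist w z < \<delta>2 \<Longrightarrow> dist (\<chi> i k. H i k w) (\<chi> i k. H i k z) < \<epsilon>"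
    using uc(2) \<epsilon> unfolding uniformly_continuous_on_def by metis
  have g_close: "\<bar>g j w - g j z\<bar> \<le> \<epsilon>" if "z \<in> K" "w \<in> K" "dist w z < \<delta>1" for z w j
    using \<delta>1(2)[OF that] Finite_Cartesian_Product.norm_nth_le[of "(\<chi> j. g j w) - (\<chi> j. g j z)" j] by (simp add: dist_norm)
  have H_close: "\<bar>H i k w - H i k z\<bar> \<le> \<epsilon>" if "z \<in> K" "w \<in> K" "dist w z < \<delta>2" for z w i k
    using \<delta>2(2)[OF that] Finite_Cartesian_Product.norm_nth_le[of "(\<chi> i k. H i k w) - (\<chi> i k. H i k z)" i]
      Finite_Cartesian_Product.norm_nth_le[of "((\<chi> i k. H i k w) - (\<chi> i k. H i k z)) $ i" k] by (simp add: dist_norm)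
  \<comment> \<open>The half is for \<open>?z2\<close>, where both coordinates have moved and the
    norm of the pair is bounded by the sum of two norms.\<close>
  define d where "d = min \<delta>1 \<delta>2 / 2"
  have d: "0 < d" using \<delta>1 \<delta>2 by (simp add: d_def)
  have "uniformly_continuous_on {0..T} x" "uniformly_continuous_on {0..T} A"
    using x A by (auto intro: compact_uniformly_continuous)
  then obtain \<eta>1 \<eta>2 where \<eta>: "\<eta>1 > 0" "\<eta>2 > 0"
      "\<And>u v. u \<in> {0..T} \<Longrightarrow> v \<in> {0..T} \<Longrightarrow> dist v u < \<eta>1 \<Longrightarrow> dist (x v) (x u) < d"
      "\<And>u v. u \<in> {0..T} \<Longrightarrow> v \<in> {0..T} \<Longrightarrow> dist v u < \<eta>2 \<Longrightarrow> dist (A v) (A u) < d"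
    using d unfolding uniformly_continuous_on_def by metis
  show ?thesis
  proof (intro exI[of _ "min \<eta>1 \<eta>2"] conjI ballI impI)
    show "0 < min \<eta>1 \<eta>2" using \<eta> by simp
    fix u v assume u: "u \<in> {0..T}" and v: "v \<in> {u..T}" and uv: "v - u < min \<eta>1 \<eta>2"
    define h k where "h = x v - x u" and "k = A v - A u"
    have v': "v \<in> {0..T}" using u v by auto
    have hk: "norm h < d" "norm k < d"
      using \<eta>(3)[OF u v'] \<eta>(4)[OF u v'] u v uv by (auto simp: h_def k_def dist_norm)
    obtain \<xi> where \<xi>: "\<xi> \<in> {0..1}"
      "G (x u + h, A u) - G (x u, A u) - (\<Sum>i\<in>UNIV. grad1 G (x u, A u) $ i * h $ i) =
        (\<Sum>i\<in>UNIV. \<Sum>k\<in>UNIV. H i k (x u + \<xi> *\<^sub>R h, A u) / 2 * (h $ i * h $ k))"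
      using C21_taylor1[OF G] unfolding H_def by blast
    obtain \<zeta> where \<zeta>: "\<zeta> \<in> {0..1}"
      "G (x v, A u + k) - G (x v, A u) = (\<Sum>j\<in>UNIV. g j (x v, A u + \<zeta> *\<^sub>R k) * k $ j)"
      using C21_taylor2[OF G] unfolding g_def by blast
    let ?z = "(x u, A u)" and ?z1 = "(x u + \<xi> *\<^sub>R h, A u)" and ?z2 = "(x v, A u + \<zeta> *\<^sub>R k)"
    have "x u + \<xi> *\<^sub>R h \<in> cball 0 B1"
      using convexD_alt[OF convex_cball[of "0 :: real ^ 'd" B1], of "x u" "x v" \<xi>] B1[OF u] B1[OF v'] \<xi>(1)
      by (simp add: h_def algebra_simps)
    moreover have "A u + \<zeta> *\<^sub>R k \<in> cball 0 B2"
      using convexD_alt[OF convex_cball[of "0 :: real ^ 'm" B2], of "A u" "A v" \<zeta>] B2[OF u] B2[OF v'] \<zeta>(1)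
      by (simp add: k_def algebra_simps)
    ultimately have K: "?z \<in> K" "?z1 \<in> K" "?z2 \<in> K"
      using B1[OF u] B1[OF v'] B2[OF u] by (auto simp: K_def)
    have n: "norm (\<xi> *\<^sub>R h) < d" "norm (\<zeta> *\<^sub>R k) < d"
      using \<xi>(1) \<zeta>(1) hk mult_left_le_one_le[of "norm h" \<xi>] mult_left_le_one_le[of "norm k" \<zeta>] by auto
    have dist1: "dist ?z1 ?z < \<delta>2"
      using n(1) d norm_Pair_le[of "\<xi> *\<^sub>R h" "0 :: real ^ 'm"] \<delta>1(1) \<delta>2(1)
      by (simp add: dist_norm d_def min_def split: if_splits)
    have dist2: "dist ?z2 ?z < \<delta>1"
      using n(2) hk(1) d norm_Pair_le[of "h" "\<zeta> *\<^sub>R k"] \<delta>1(1) \<delta>2(1)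
      by (simp add: dist_norm d_def h_def min_def split: if_splits)
    have eq1: "remainder G x A u v - main_part G x A u v =
        (G (x v, A u + k) - G (x v, A u) - (\<Sum>j\<in>UNIV. g j ?z * k $ j)) +
        (G (x u + h, A u) - G (x u, A u) - (\<Sum>i\<in>UNIV. grad1 G (x u, A u) $ i * h $ i) -
          (\<Sum>i\<in>UNIV. \<Sum>k\<in>UNIV. H i k ?z / 2 * (h $ i * h $ k)))"
      by (simp add: remainder_def main_part_def h_def k_def g_def H_def)
    have eq2: "\<dots> = (\<Sum>j\<in>UNIV. (g j ?z2 - g j ?z) * k $ j) +
        (\<Sum>i\<in>UNIV. \<Sum>k\<in>UNIV. (H i k ?z1 - H i k ?z) / 2 * (h $ i * h $ k))"
      unfolding \<xi>(2) \<zeta>(2) by (simp add: sum_subtractf left_diff_distrib diff_divide_distrib)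
    have "\<bar>\<dots>\<bar> \<le> (\<Sum>j\<in>UNIV. \<epsilon> * \<bar>k $ j\<bar>) +
        (\<Sum>i\<in>UNIV. \<Sum>k\<in>UNIV. \<epsilon> * \<bar>h $ i * h $ k\<bar>)"
    proof (intro abs_triangle_ineq[THEN order_trans] add_mono sum_abs[THEN order_trans] sum_mono)
      fix j show "\<bar>(g j ?z2 - g j ?z) * k $ j\<bar> \<le> \<epsilon> * \<bar>k $ j\<bar>"
        unfolding abs_mult by (intro mult_right_mono g_close K dist2) auto
    next
      fix i l
      have "\<bar>(H i l ?z1 - H i l ?z) / 2\<bar> \<le> \<epsilon>"
        using H_close[OF K(1,2) dist1, of i l] \<epsilon> by simp
      then show "\<bar>(H i l ?z1 - H i l ?z) / 2 * (h $ i * h $ l)\<bar> \<le> \<epsilon> * \<bar>h $ i * h $ l\<bar>"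
        unfolding abs_mult[of _ "h $ i * h $ l"] by (intro mult_right_mono) auto
    qed
    also have "\<dots> = \<epsilon> * ((\<Sum>j\<in>UNIV. \<bar>k $ j\<bar>) + (\<Sum>i\<in>UNIV. \<Sum>k\<in>UNIV. \<bar>h $ i * h $ k\<bar>))"
      by (simp add: sum_distrib_left distrib_left)
    finally show "\<bar>remainder G x A u v - main_part G x A u v\<bar> \<le>
      \<epsilon> * ((\<Sum>j\<in>UNIV. \<bar>A v $ j - A u $ j\<bar>) +
        (\<Sum>i\<in>UNIV. \<Sum>k\<in>UNIV. \<bar>(x v $ i - x u $ i) * (x v $ k - x u $ k)\<bar>))"
      unfolding eq1 eq2 by (simp add: h_def k_def)
  qed
qed

subsection \<open>Stieltjes integrals against monotone functions\<close>

lemma variation_sum_mono_le: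
  fixes F :: "real \<Rightarrow> real"
  assumes F: "mono_on {a..b} F" and D: "finite D" "D \<subseteq> {a..b}" and ab: "a \<le> b"
  shows "variation_sum F D \<le> F b - F a"
proof (cases "D = {}")
  case True
  have "consecutive D = {}" using True by (auto simp: consecutive_def)
  then show ?thesis using F ab by (simp add: variation_sum_def mono_on_def)
next
  case False
  have "variation_sum F D = (\<Sum>(u, v)\<in>consecutive D. F v - F u)"
    unfolding variation_sum_def
  proof (intro sum.cong refl, clarify)
    fix u v assume "(u, v) \<in> consecutive D"
    then have "F u \<le> F v"
      using consecutiveD[of u v D] D by (intro mono_onD[OF F]) auto
    then show "norm (F v - F u) = F v - F u" by simp
  qed
  also have "\<dots> = F (Max D) - F (Min D)"
    by (rule sum_consecutive_telescope) (use D False in auto)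
  also have "\<dots> \<le> F b - F a"
  proof -
    have "Max D \<in> {a..b}" "Min D \<in> {a..b}" using D False Max_in Min_in by blast+
    then show ?thesis
      using mono_onD[OF F, of "Max D" b] mono_onD[OF F, of a "Min D"] ab by force
  qed
  finally show ?thesis .
qed

text \<open>The supremum is attained at \<open>{a, b}\<close>. Hence for a nondecreasing
  \<open>F\<close> the subtracted function in \<open>stieltjes_integral\<close> is constant.\<close>

lemma total_variation_mono:
  fixes F :: "real \<Rightarrow> real"
  assumes F: "mono_on {a..b} F" and ab: "a \<le> b"
  shows "total_variation a b F = F b - F a"
  unfolding total_variation_def
proof (rule cSup_eq_maximum)
  have "(\<Sum>(u, v)\<in>consecutive {a, b}. F v - F u) = F b - F a"
    using ab by (simp add: sum_consecutive_telescope max_def min_def)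
  moreover have "F u \<le> F v" if "(u, v) \<in> consecutive {a, b}" for u v
    using consecutiveD[OF that] ab by (intro mono_onD[OF F]) auto
  then have "variation_sum F {a, b} = (\<Sum>(u, v)\<in>consecutive {a, b}. F v - F u)"
    unfolding variation_sum_def by (intro sum.cong) auto
  ultimately have "variation_sum F {a, b} = F b - F a" by simp
  then show "F b - F a \<in> variation_sum F ` {D. finite D \<and> D \<subseteq> {a..b}}"
    using ab by (intro image_eqI[of _ _ "{a, b}"]) auto
  show "x \<le> F b - F a" if "x \<in> variation_sum F ` {D. finite D \<and> D \<subseteq> {a..b}}" for x
    using that variation_sum_mono_le[OF F _ _ ab] by auto
qed

text \<open>Interval measures see only increments. This allows the clamping at a varying upper limit
  of integration to be exchanged for a clamping at one fixed end point.\<close>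

lemma set_integral_interval_measure_cong:
  fixes F F' f :: "real \<Rightarrow> real"
  assumes F: "\<And>x y. x \<le> y \<Longrightarrow> F x \<le> F y" "\<And>x. continuous (at_right x) F"
    and F': "\<And>x y. x \<le> y \<Longrightarrow> F' x \<le> F' y" "\<And>x. continuous (at_right x) F'"
    and eq: "\<And>x. x \<in> {a..b} \<Longrightarrow> F x = F' x + c"
  shows "(LINT s:{a<..b}|interval_measure F. f s) = (LINT s:{a<..b}|interval_measure F'. f s)"
proof -
  let ?S = "{a<..b}"
  \<comment> \<open>Multiplying by the indicator keeps both measures on the whole Borel line, where
    their values on half-open intervals, a generator stable under intersection, determine
    them.\<close>
  let ?d = "\<lambda>F. density (interval_measure F) (indicator ?S)"
  have em: "emeasure (?d F) X = emeasure (interval_measure F) (X \<inter> ?S)" if "X \<in> sets borel" for F X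
    using that by (subst emeasure_density) (auto simp: indicator_inter_arith[symmetric] Int_commute)
  have Ioc: "{x<..y} \<inter> ?S = {max x a<..min y b}" for x y by auto
  have "?d F = ?d F'"
  proof (rule measure_eqI_generator_eq[where E = "range (\<lambda>(x, y). {x<..y})" and \<Omega> = UNIV
        and A = "\<lambda>i. {- real i<..real i}"])
    show "Int_stable (range (\<lambda>(x, y). {x<..y :: real}))"
    proof (rule Int_stableI)
      fix A B assume "A \<in> range (\<lambda>(x, y). {x<..y :: real})" "B \<in> range (\<lambda>(x, y). {x<..y :: real})"
      then obtain x y x' y' where "A = {x<..y}" "B = {x'<..y'}" by auto
      then have "A \<inter> B = {max x x'<..min y y'}" by auto
      then show "A \<inter> B \<in> range (\<lambda>(x, y). {x<..y :: real})" by auto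
    qed
    fix X assume "X \<in> range (\<lambda>(x, y). {x<..y :: real})"
    then obtain x y where X: "X = {x<..y}" by auto
    have Xb: "X \<in> sets borel" unfolding X by simp
    let ?p = "max x a" and ?q = "min y b"
    have "emeasure (interval_measure F) {?p<..?q} = (if ?p \<le> ?q then F ?q - F ?p else 0)"
      by (rule emeasure_interval_measure_Ioc_eq[OF F])
    moreover have "emeasure (interval_measure F') {?p<..?q} = (if ?p \<le> ?q then F' ?q - F' ?p else 0)"
      by (rule emeasure_interval_measure_Ioc_eq[OF F'])
    moreover have "F ?q - F ?p = F' ?q - F' ?p" if "?p \<le> ?q"
      using eq[of ?p] eq[of ?q] that by simp
    ultimately show "emeasure (?d F) X = emeasure (?d F') X"
      unfolding X em[OF Xb[unfolded X]] Ioc by simp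
  next
    show "sets (?d F) = sigma_sets UNIV (range (\<lambda>(x, y). {x<..y}))"
      "sets (?d F') = sigma_sets UNIV (range (\<lambda>(x, y). {x<..y}))"
      by (simp_all add: borel_sigma_sets_Ioc)
    show "(\<Union>i. {- real i<..real i}) = UNIV"
    proof (intro set_eqI iffI)
      fix x :: real
      obtain n where "\<bar>x\<bar> < real n" using reals_Archimedean2 by blast
      then show "x \<in> (\<Union>i. {- real i<..real i})" by (intro UN_I[of n]) auto
    qed simp
    show "emeasure (?d F) {- real i<..real i} \<noteq> \<infinity>" for i
      by (subst em) (auto simp: Ioc emeasure_interval_measure_Ioc_eq[where F = F, OF F])
  qed auto
  then have eqE: "emeasure (interval_measure F) X = emeasure (interval_measure F') X"
    if "X \<in> sets borel" "X \<subseteq> ?S" for X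
    using em[of X F] em[of X F'] that by (simp add: inf_absorb1)
  have "restrict_space (interval_measure F) ?S = restrict_space (interval_measure F') ?S"
  proof (rule measure_eqI)
    show "sets (restrict_space (interval_measure F) ?S) = sets (restrict_space (interval_measure F') ?S)"
      by (simp add: sets_restrict_space)
    fix X assume "X \<in> sets (restrict_space (interval_measure F) ?S)"
    then have "X \<in> sets borel" "X \<subseteq> ?S" by (auto simp: sets_restrict_space)
    then show "emeasure (restrict_space (interval_measure F) ?S) X =
        emeasure (restrict_space (interval_measure F') ?S) X"
      by (simp add: emeasure_restrict_space eqE)
  qed
  then show ?thesis
    using integral_restrict_space[of ?S "interval_measure F" f]
      integral_restrict_space[of ?S "interval_measure F'" f]
    by (simp add: set_lebesgue_integral_def)
qed

lemma set_integral_interval_measure_bounds: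
  fixes F f :: "real \<Rightarrow> real"
  assumes F: "\<And>x y. x \<le> y \<Longrightarrow> F x \<le> F y" "\<And>x. continuous (at_right x) F"
    and f: "continuous_on {a..b} f" and ab: "a \<le> b"
  shows "set_integrable (interval_measure F) {a<..b} f"
    "(\<And>s. s \<in> {a..b} \<Longrightarrow> c \<le> f s) \<Longrightarrow> c * (F b - F a) \<le> (LINT s:{a<..b}|interval_measure F. f s)"
    "(\<And>s. s \<in> {a..b} \<Longrightarrow> f s \<le> c) \<Longrightarrow> (LINT s:{a<..b}|interval_measure F. f s) \<le> c * (F b - F a)"
proof -
  let ?N = "interval_measure F"
  have em: "emeasure ?N {a<..b} = F b - F a" "measure ?N {a<..b} = F b - F a"
    using ab F by (simp_all add: emeasure_interval_measure_Ioc measure_interval_measure_Ioc)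
  have int: "set_integrable ?N {a<..b} g" if g: "continuous_on {a..b} g" for g :: "real \<Rightarrow> real"
  proof -
    obtain B where B: "\<And>s. s \<in> {a..b} \<Longrightarrow> norm (g s) \<le> B"
      using continuous_on_Icc_norm_bound[OF g] by blast
    have "continuous_on {a<..b} g" by (rule continuous_on_subset[OF g]) auto
    then have "(\<lambda>x. indicat_real {a<..b} x *\<^sub>R g x) \<in> borel_measurable ?N"
      unfolding measurable_cong_sets[OF sets_interval_measure refl]
      by (intro borel_measurable_continuous_on_indicator) auto
    then show ?thesis
      unfolding set_integrable_def
      by (rule integrableI_bounded_set[where A = "{a<..b}" and B = B, rotated])
        (use B in \<open>auto simp: em\<close>)
  qed
  show 1: "set_integrable ?N {a<..b} f" by (rule int[OF f])
  have const: "(LINT s:{a<..b}|?N. c) = c * (F b - F a)"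
    unfolding set_lebesgue_integral_def by (simp add: em)
  show "c * (F b - F a) \<le> (LINT s:{a<..b}|?N. f s)" if "\<And>s. s \<in> {a..b} \<Longrightarrow> c \<le> f s"
    unfolding const[symmetric] by (rule set_integral_mono[OF int 1]) (use that in auto)
  show "(LINT s:{a<..b}|?N. f s) \<le> c * (F b - F a)" if "\<And>s. s \<in> {a..b} \<Longrightarrow> f s \<le> c"
    unfolding const[symmetric] by (rule set_integral_mono[OF 1 int]) (use that in auto)
qed

text \<open>The measure on the right does not depend on \<open>t\<close>, so integrals with
  different upper limits can be subtracted. Of the two measures in the definition, the second
  belongs to a constant and is null.\<close>

lemma stieltjes_integral_mono:
  fixes F f :: "real \<Rightarrow> real"
  assumes F: "mono_on {a..b} F" "continuous_on {a..b} F" and f: "continuous_on {a..b} f"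
    and t: "t \<in> {a..b}"
  shows "stieltjes_integral a t f F =
    (LINT s:{a<..t}|interval_measure (\<lambda>s. F (max a (min b s))). f s)"
proof -
  let ?c = "\<lambda>b s. max a (min b s)"
  have clamp: "F (?c r x) \<le> F (?c r y)" if "x \<le> y" "r \<in> {a..b}" for x y r
    using that by (intro mono_onD[OF F(1)]) auto
  have cont: "continuous (at_right x) (\<lambda>s. F (?c r s))" if "r \<in> {a..b}" for x r
  proof -
    have "continuous_on UNIV (\<lambda>s. F (?c r s))"
      using that by (intro continuous_on_compose2[OF F(2)] continuous_intros) auto
    then show ?thesis
      by (meson UNIV_I continuous_at_imp_continuous_at_within continuous_on_eq_continuous_at open_UNIV)
  qed
  have V: "total_variation a (?c t s) F = F (?c t s) - F a" for s
    using t by (intro total_variation_mono mono_on_subset[OF F(1)]) auto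
  have "stieltjes_integral a t f F =
      (LINT s:{a<..t}|interval_measure (\<lambda>s. F (?c t s) - F a). f s) -
      (LINT s:{a<..t}|interval_measure (\<lambda>s. - F a). f s)"
    unfolding stieltjes_integral_def Let_def V by simp
  \<comment> \<open>On an interval of mass zero the upper and lower bounds squeeze the integral to
    zero.\<close>
  also have "(LINT s:{a<..t}|interval_measure (\<lambda>s. - F a). f s) = 0"
  proof -
    have ft: "continuous_on {a..t} f" using t by (auto intro: continuous_on_subset[OF f])
    obtain B where B: "\<And>s. s \<in> {a..t} \<Longrightarrow> norm (f s) \<le> B"
      using continuous_on_Icc_norm_bound[OF ft] by blast
    then have B': "- B \<le> f s" "f s \<le> B" if "s \<in> {a..t}" for s
      using that by (force simp: abs_le_iff)+
    note b = set_integral_interval_measure_bounds[of "\<lambda>s. - F a" a t f]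
    show ?thesis
      using b(2)[of "- B"] b(3)[of B] ft B' t by force
  qed
  also have "(LINT s:{a<..t}|interval_measure (\<lambda>s. F (?c t s) - F a). f s) =
      (LINT s:{a<..t}|interval_measure (\<lambda>s. F (?c b s)). f s)"
  proof (rule set_integral_interval_measure_cong[where c = "- F a"])
    show "F (?c t x) - F a \<le> F (?c t y) - F a" if "x \<le> y" for x y
      using clamp[OF that t] by simp
    show "F (?c b x) \<le> F (?c b y)" if "x \<le> y" for x y
      using clamp[OF that] t by simp
    show "continuous (at_right x) (\<lambda>s. F (?c t s) - F a)" for x
      by (intro continuous_intros cont t)
    show "continuous (at_right x) (\<lambda>s. F (?c b s))" for x
      using t by (intro cont) auto
    show "F (?c t x) - F a = F (?c b x) + - F a" if "x \<in> {a..t}" for x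
      using that t by (simp add: min_absorb2 max_absorb2)
  qed
  finally show ?thesis by simp
qed

text \<open>One measure serves both upper limits, so the difference is the integral over
  \<open>(u,v]\<close>, which is compared with constants. These bounds carry the relation
  \<open>dK = d\<Gamma> / Y\<close> into the discrete estimates.\<close>

lemma stieltjes_integral_increment_bounds:
  fixes F f :: "real \<Rightarrow> real"
  assumes F: "mono_on {a..b} F" "continuous_on {a..b} F" and f: "continuous_on {a..b} f"
    and u: "a \<le> u" and uv: "u \<le> v" and v: "v \<le> b"
  shows "(\<And>s. s \<in> {u..v} \<Longrightarrow> c \<le> f s) \<Longrightarrow>
      c * (F v - F u) \<le> stieltjes_integral a v f F - stieltjes_integral a u f F"
    "(\<And>s. s \<in> {u..v} \<Longrightarrow> f s \<le> c) \<Longrightarrow>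
      stieltjes_integral a v f F - stieltjes_integral a u f F \<le> c * (F v - F u)"
proof -
  let ?F = "\<lambda>s. F (max a (min b s))"
  have mono: "?F x \<le> ?F y" if "x \<le> y" for x y
    using that u uv v by (intro mono_onD[OF F(1)]) auto
  have cont: "continuous (at_right x) ?F" for x
  proof -
    have "continuous_on UNIV ?F"
      using u uv v by (intro continuous_on_compose2[OF F(2)] continuous_intros) auto
    then show ?thesis
      by (meson UNIV_I continuous_at_imp_continuous_at_within continuous_on_eq_continuous_at open_UNIV)
  qed
  have sub: "continuous_on {x..y} f" if "a \<le> x" "y \<le> b" for x y
    using that by (intro continuous_on_subset[OF f]) auto
  note bd = set_integral_interval_measure_bounds[OF mono cont sub]
  have "{a<..u} \<union> {u<..v} = {a<..v}" using u uv by auto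
  then have "(LINT s:{a<..v}|interval_measure ?F. f s) =
      (LINT s:{a<..u}|interval_measure ?F. f s) + (LINT s:{u<..v}|interval_measure ?F. f s)"
    using set_integral_Un[OF _ bd(1)[of a u] bd(1)[of u v]] u uv v by auto
  then have eq: "stieltjes_integral a v f F - stieltjes_integral a u f F =
      (LINT s:{u<..v}|interval_measure ?F. f s)"
    using u uv v by (simp add: stieltjes_integral_mono[OF F f])
  have "?F u = F u" "?F v = F v" using u uv v by (simp_all add: min_absorb2 max_absorb2)
  then show "(\<And>s. s \<in> {u..v} \<Longrightarrow> c \<le> f s) \<Longrightarrow>
      c * (F v - F u) \<le> stieltjes_integral a v f F - stieltjes_integral a u f F"
    "(\<And>s. s \<in> {u..v} \<Longrightarrow> f s \<le> c) \<Longrightarrow>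
      stieltjes_integral a v f F - stieltjes_integral a u f F \<le> c * (F v - F u)"
    using bd(2)[of u v c] bd(3)[of u v c] u uv v unfolding eq by simp_all
qed

lemma stieltjes_integral_same [simp]: "stieltjes_integral a a f F = 0"
  by (simp add: stieltjes_integral_def set_lebesgue_integral_def)

subsection \<open>Multiplicatively generated strategies\<close>

context partition_sequence
begin

text \<open>The sums telescope, so every distribution function already equals its limit. The mass is
  a variation sum of \<open>A\<close> over the cut partition, a coordinate moving no more than the
  vector.\<close>

lemma integrator_CBV:
  fixes A :: "real \<Rightarrow> real ^ 'm"
  assumes A: "CBV T A"
  shows "integrator (\<lambda>u v. A v $ j - A u $ j) (\<lambda>t. A t $ j - A 0 $ j)"
  unfolding integrator_def
proof (intro conjI allI ballI)
  show "bounded_sums (\<lambda>u v. \<bar>A v $ j - A u $ j\<bar>)"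
  proof -
    obtain B where B: "\<And>D. finite D \<Longrightarrow> D \<subseteq> {0..T} \<Longrightarrow> variation_sum A D \<le> B"
      using A by (auto simp: CBV_def bounded_variation_on_def bdd_above_def)
    have "sum_upto (P n) t (\<lambda>u v. norm (A v - A u)) \<le> B" if t: "t \<in> {0..T}" for n t
      unfolding sum_upto_eq_consecutive[OF partition_of_P t, of "\<lambda>u v. norm (A v - A u)", simplified]
      using t partition_of_P[of n] B[of "insert t (P n \<inter> {..t})"]
      by (auto simp: partition_of_def variation_sum_def)
    then have "bounded_sums (\<lambda>u v. norm (A v - A u))"
      unfolding bounded_sums_def by (intro exI[of _ B]) simp
    then show ?thesis
      by (rule bounded_sums_le)
        (metis Finite_Cartesian_Product.norm_nth_le real_norm_def vector_minus_component)
  qed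
  show "(\<lambda>n. sum_upto (P n) t (\<lambda>u v. A v $ j - A u $ j)) \<longlonglongrightarrow> A t $ j - A 0 $ j" if "t \<in> {0..T}" for t
    by (simp add: sum_upto_telescope[OF partition_of_P that, where h = "\<lambda>s. A s $ j"])
  show "continuous_on {0..T} (\<lambda>t. A t $ j - A 0 $ j)"
    using A by (auto simp: CBV_def intro!: continuous_intros)
qed simp

text \<open>Convergence is assumed, and the mass bound is the point. Products are dominated by
  squares, whose sums up to \<open>T\<close> converge and are therefore bounded; stopping earlier
  costs at most one further squared increment.\<close>

lemma integrator_covariation:
  fixes x :: "real \<Rightarrow> real ^ 'd"
  assumes qc: "has_quadratic_covariations T P x" and x: "continuous_on {0..T} x"
  shows "\<exists>q. integrator (\<lambda>u v. (x v $ i - x u $ i) * (x v $ k - x u $ k)) q"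
proof -
  have sq: "bounded_sums (\<lambda>u v. (x v $ i - x u $ i) * (x v $ i - x u $ i))" for i
  proof -
    let ?w = "\<lambda>u v. (x v $ i - x u $ i) * (x v $ i - x u $ i)"
    have "continuous_on {0..T} (\<lambda>t. x t $ i)" using x by (intro continuous_intros)
    then obtain B where B: "\<And>t. t \<in> {0..T} \<Longrightarrow> \<bar>x t $ i\<bar> \<le> B"
      using continuous_on_Icc_norm_bound[of 0 T "\<lambda>t. x t $ i"] by auto
    have w: "?w u v \<le> (2 * B) * (2 * B)" if "u \<in> {0..T}" "v \<in> {0..T}" for u v
    proof -
      have "\<bar>x v $ i - x u $ i\<bar> \<le> 2 * B" using B[OF that(1)] B[OF that(2)] by linarith
      then have "\<bar>x v $ i - x u $ i\<bar> * \<bar>x v $ i - x u $ i\<bar> \<le> (2 * B) * (2 * B)"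
        by (intro mult_mono) auto
      then show ?thesis by simp
    qed
    have "convergent (\<lambda>n. sum_upto (P n) T ?w)"
      using qc T_pos unfolding has_quadratic_covariations_def convergent_def by force
    then obtain C where C: "\<forall>n. norm (sum_upto (P n) T ?w) \<le> C"
      using convergent_imp_Bseq BseqE by blast
    have "sum_upto (P n) t ?w \<le> C + (2 * B) * (2 * B)" if "t \<in> {0..T}" for n t
      using sum_upto_le_total[OF partition_of_P that, of ?w "(2 * B) * (2 * B)" n] w
        spec[OF C, of n] by force
    then show ?thesis
      unfolding bounded_sums_def by (intro exI always_eventually) blast
  qed
  obtain q where q: "continuous_on {0..T} q"
    "\<And>t. t \<in> {0..T} \<Longrightarrow> (\<lambda>n. sum_upto (P n) t (\<lambda>u v. (x v $ i - x u $ i) * (x v $ k - x u $ k))) \<longlonglongrightarrow> q t"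
    using qc unfolding has_quadratic_covariations_def by blast
  have "bounded_sums (\<lambda>u v. \<bar>(x v $ i - x u $ i) * (x v $ k - x u $ k)\<bar>)"
    using bounded_sums_add[OF sq[of i] sq[of k]]
  proof (rule bounded_sums_le)
    fix u v
    have "\<bar>a * b\<bar> \<le> a * a + b * b" for a b :: real
    proof -
      have "2 * (\<bar>a\<bar> * \<bar>b\<bar>) \<le> a * a + b * b"
        using zero_le_power2[of "\<bar>a\<bar> - \<bar>b\<bar>"] by (simp add: power2_eq_square algebra_simps)
      moreover have "0 \<le> \<bar>a\<bar> * \<bar>b\<bar>" by simp
      ultimately show ?thesis unfolding abs_mult by linarith
    qed
    then show "\<bar>(x v $ i - x u $ i) * (x v $ k - x u $ k)\<bar> \<le>
        (x v $ i - x u $ i) * (x v $ i - x u $ i) + (x v $ k - x u $ k) * (x v $ k - x u $ k)" .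
  qed
  with q show ?thesis unfolding integrator_def by (intro exI[of _ q]) simp
qed

lemma ex_integrator_sum:
  assumes "\<And>i. i \<in> I \<Longrightarrow> \<exists>J. integrator (f i) J"
  shows "\<exists>J. integrator (\<lambda>u v. \<Sum>i\<in>I. f i u v) J"
proof -
  have "\<forall>i\<in>I. \<exists>J. integrator (f i) J" using assms by blast
  from bchoice[OF this] obtain J where "\<forall>i\<in>I. integrator (f i) (J i)" by blast
  then show ?thesis using integrator_sum[of I f J] by blast
qed

text \<open>Each term of \<open>main_part\<close> is a known integrator with a continuous weight,
  and passing to the remainder is a negligible perturbation.\<close>

lemma integrator_remainder:
  fixes G :: "(real ^ 'd) \<times> (real ^ 'm) \<Rightarrow> real"
  assumes G: "C21 G" and x: "continuous_on {0..T} x" and qc: "has_quadratic_covariations T P x"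
    and A: "CBV T A"
  shows "\<exists>R. integrator (remainder G x A) R"
proof -
  have cA: "continuous_on {0..T} A" using A by (simp add: CBV_def)
  have path: "continuous_on {0..T} (\<lambda>u. f (x u, A u))" if "continuous_on UNIV f"
    for f :: "(real ^ 'd) \<times> (real ^ 'm) \<Rightarrow> real"
    by (intro continuous_on_compose2[OF that] continuous_intros x cA) auto
  have 1: "\<exists>J. integrator (\<lambda>u v. dir_deriv G (e2 j) (x u, A u) * (A v $ j - A u $ j)) J" for j
  proof -
    have "continuous_on {0..T} (\<lambda>u. dir_deriv G (e2 j) (x u, A u))"
      using G by (intro path) (simp add: C21_def C1_along_def)
    from integrator_mult[OF integrator_CBV[OF A] this] show ?thesis by blast
  qed
  have 2: "\<exists>J. integrator (\<lambda>u v. dir_deriv (dir_deriv G (e1 i)) (e1 k) (x u, A u) / 2 *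
      ((x v $ i - x u $ i) * (x v $ k - x u $ k))) J" for i k
  proof -
    obtain q where q: "integrator (\<lambda>u v. (x v $ i - x u $ i) * (x v $ k - x u $ k)) q"
      using integrator_covariation[OF qc x] by blast
    have "continuous_on {0..T} (\<lambda>u. dir_deriv (dir_deriv G (e1 i)) (e1 k) (x u, A u) / 2)"
      using G by (intro continuous_on_divide path continuous_on_const) (simp_all add: C21_def C1_along_def)
    from integrator_mult[OF q this] show ?thesis by blast
  qed
  obtain M where M: "integrator (main_part G x A) M"
  proof -
    have "\<exists>J. integrator (\<lambda>u v. \<Sum>j\<in>UNIV. dir_deriv G (e2 j) (x u, A u) * (A v $ j - A u $ j)) J"
      by (intro ex_integrator_sum 1)
    then obtain J1 where "integrator (\<lambda>u v. \<Sum>j\<in>UNIV.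
        dir_deriv G (e2 j) (x u, A u) * (A v $ j - A u $ j)) J1" ..
    moreover have "\<exists>J. integrator (\<lambda>u v. \<Sum>i\<in>UNIV. \<Sum>k\<in>UNIV.
        dir_deriv (dir_deriv G (e1 i)) (e1 k) (x u, A u) / 2 * ((x v $ i - x u $ i) * (x v $ k - x u $ k))) J"
      by (intro ex_integrator_sum 2)
    then obtain J2 where "integrator (\<lambda>u v. \<Sum>i\<in>UNIV. \<Sum>k\<in>UNIV.
        dir_deriv (dir_deriv G (e1 i)) (e1 k) (x u, A u) / 2 * ((x v $ i - x u $ i) * (x v $ k - x u $ k))) J2" ..
    ultimately have "integrator (main_part G x A) (\<lambda>t. J1 t + J2 t)"
      unfolding main_part_def by (rule integrator_add)
    then show thesis by (rule that)
  qed
  have "bounded_sums (\<lambda>u v. \<bar>A v $ j - A u $ j\<bar>)" for j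
    by (rule integratorD(2)[OF integrator_CBV[OF A]])
  moreover have "bounded_sums (\<lambda>u v. \<bar>(x v $ i - x u $ i) * (x v $ k - x u $ k)\<bar>)" for i k
    using integrator_covariation[OF qc x, of i k] integratorD(2) by blast
  ultimately have "bounded_sums (\<lambda>u v. (\<Sum>j\<in>UNIV. \<bar>A v $ j - A u $ j\<bar>) +
      (\<Sum>i\<in>UNIV. \<Sum>k\<in>UNIV. \<bar>(x v $ i - x u $ i) * (x v $ k - x u $ k)\<bar>))"
    by (intro bounded_sums_add bounded_sums_sum)
  then have "integrator (remainder G x A) M"
    by (rule integrator_perturb[OF M _ _ remainder_main_part[OF G x cA]]) (simp add: remainder_def)
  then show ?thesis by blast
qed

text \<open>
  Summation by parts turns the integral of \<open>\<eta>\<close> into that of \<open>- exp K \<cdot> d\<Gamma>\<close> and \<open>Y \<cdot> d(exp K)\<close>,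
  which cancel because \<open>dK = d\<Gamma> / Y\<close>.
\<close>

lemma foellmer_integral_multiplicative:
  fixes G :: "(real ^ 'd) \<times> (real ^ 'm) \<Rightarrow> real" and x :: "real \<Rightarrow> real ^ 'd" and A :: "real \<Rightarrow> real ^ 'm"
  defines "Y \<equiv> \<lambda>t. G (x t, A t)" and "\<Gamma> \<equiv> Gamma_process P G x A"
  defines "K \<equiv> \<lambda>t. stieltjes_integral 0 t (\<lambda>s. 1 / Y s) \<Gamma>"
  assumes G: "C21 G" and x: "continuous_on {0..T} x" and qc: "has_quadratic_covariations T P x"
    and A: "CBV T A" and \<alpha>: "0 < \<alpha>" and bounds: "\<And>t. t \<in> {0..T} \<Longrightarrow> \<alpha> \<le> Y t \<and> Y t \<le> \<beta>"
    and mono: "mono_on {0..T} \<Gamma>" and t: "t \<in> {0..T}"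
  shows "foellmer_integral P (multiplicative_integrand P G x A) x t = Y t * exp (K t) - Y 0"
    and "\<Gamma> t / \<beta> \<le> K t"
proof -
  have cA: "continuous_on {0..T} A" using A by (simp add: CBV_def)
  obtain R where R: "integrator (remainder G x A) R"
    using integrator_remainder[OF G x qc A] by blast
  have YY: "(\<Sum>i\<in>UNIV. grad1 G (x u, A u) $ i * (x v $ i - x u $ i)) = (Y v - Y u) - remainder G x A u v" for u v
    by (simp add: remainder_def Y_def)
  \<comment> \<open>By \<open>YY\<close> the Foellmer sums are telescoping increments of
    \<open>Y\<close> minus sums of the remainder, so their limit exists.\<close>
  have \<Gamma>R: "\<Gamma> s = - R s" if s: "s \<in> {0..T}" for s
  proof -
    have "(\<lambda>n. sum_upto (P n) s (\<lambda>u v. \<Sum>i\<in>UNIV. grad1 G (x u, A u) $ i * (x v $ i - x u $ i)))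
        \<longlonglongrightarrow> (Y s - Y 0) - R s"
      unfolding YY sum_upto_diff[where f = "\<lambda>u v. Y v - Y u"] sum_upto_telescope[OF partition_of_P s, where h = Y]
      by (intro tendsto_intros integratorD(3)[OF R s])
    then have "foellmer_integral P (\<lambda>s. grad1 G (x s, A s)) x s = Y s - Y 0 - R s"
      unfolding foellmer_integral_def by (rule limI)
    then show ?thesis by (simp add: \<Gamma>_def Gamma_process_def Y_def)
  qed
  have \<Gamma>_0: "\<Gamma> 0 = 0"
  proof -
    have "(\<lambda>n. sum_upto (P n) 0 (remainder G x A)) \<longlonglongrightarrow> R 0"
      using T_pos by (intro integratorD(3)[OF R]) auto
    then have "R 0 = 0"
      by (simp add: sum_upto_0[OF partition_of_P] remainder_def LIMSEQ_const_iff)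
    then show ?thesis using \<Gamma>R[of 0] T_pos by simp
  qed
  have cont_\<Gamma>: "continuous_on {0..T} \<Gamma>"
  proof -
    have "continuous_on {0..T} (\<lambda>s. - R s)" by (intro continuous_intros integratorD(4)[OF R])
    then show ?thesis by (rule continuous_on_eq) (simp add: \<Gamma>R)
  qed
  have cont_Y: "continuous_on {0..T} Y"
    unfolding Y_def by (intro continuous_on_compose2[OF C21_continuous[OF G]] continuous_intros x cA) auto
  have Y_pos: "0 < Y s" if "s \<in> {0..T}" for s using bounds[OF that] \<alpha> by linarith
  have cont_inv: "continuous_on {0..T} (\<lambda>s. 1 / Y s)"
    using Y_pos by (intro continuous_intros cont_Y) (metis less_irrefl)
  have incr: "(\<And>s. s \<in> {u..v} \<Longrightarrow> c \<le> 1 / Y s) \<Longrightarrow> c * (\<Gamma> v - \<Gamma> u) \<le> K v - K u"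
      "(\<And>s. s \<in> {u..v} \<Longrightarrow> 1 / Y s \<le> c) \<Longrightarrow> K v - K u \<le> c * (\<Gamma> v - \<Gamma> u)"
    if "0 \<le> u" "u \<le> v" "v \<le> T" for u v c
    unfolding K_def using stieltjes_integral_increment_bounds[OF mono cont_\<Gamma> cont_inv that] by blast+
  have K_0: "K 0 = 0" by (simp add: K_def)
  have inv_bounds: "1 / \<beta> \<le> 1 / Y s" "1 / Y s \<le> 1 / \<alpha>" if "s \<in> {0..T}" for s
    using bounds[OF that] Y_pos[OF that] \<alpha> by (auto intro: frac_le)
  have \<beta>: "0 < \<beta>" using bounds[OF t] \<alpha> by linarith
  \<comment> \<open>The lower bound makes \<open>K\<close> grow enough for the arbitrage; the upper
    one gives continuity of \<open>K\<close> and the error estimates.\<close>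
  have K_lower: "(\<Gamma> v - \<Gamma> u) / \<beta> \<le> K v - K u" and K_upper: "K v - K u \<le> (\<Gamma> v - \<Gamma> u) / \<alpha>"
    if "0 \<le> u" "u \<le> v" "v \<le> T" for u v
    using incr(1)[OF that, of "1 / \<beta>"] incr(2)[OF that, of "1 / \<alpha>"] inv_bounds that by simp_all
  have \<Gamma>_le: "\<Gamma> u \<le> \<Gamma> v" if "0 \<le> u" "u \<le> v" "v \<le> T" for u v
    using that by (intro mono_onD[OF mono]) auto
  have K_le: "K u \<le> K v" if "0 \<le> u" "u \<le> v" "v \<le> T" for u v
    using K_lower[OF that] \<Gamma>_le[OF that] \<beta> by (smt (verit) divide_nonneg_pos)
  show "\<Gamma> t / \<beta> \<le> K t"
    using K_lower[of 0 t] t \<Gamma>_0 K_0 by simp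
  have cont_K: "continuous_on {0..T} K"
  proof -
    have Lip: "\<bar>K v - K u\<bar> \<le> \<bar>\<Gamma> v - \<Gamma> u\<bar> / \<alpha>" if "u \<in> {0..T}" "v \<in> {0..T}" for u v
      using that
    proof (induction u v rule: linorder_wlog)
      case (le u v)
      then show ?case using K_le[of u v] \<Gamma>_le[of u v] K_upper[of u v] by simp
    next
      case (sym u v)
      then show ?case by (simp add: abs_minus_commute)
    qed
    show ?thesis
      unfolding continuous_on_iff
    proof (intro ballI allI impI)
      fix s e assume s: "s \<in> {0..T}" and e: "0 < (e :: real)"
      then have "0 < \<alpha> * e" using \<alpha> by simp
      then obtain d where d: "d > 0" "\<And>s'. s' \<in> {0..T} \<Longrightarrow> dist s' s < d \<Longrightarrow> dist (\<Gamma> s') (\<Gamma> s) < \<alpha> * e"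
        using cont_\<Gamma> s unfolding continuous_on_iff by metis
      have "dist (K s') (K s) < e" if "s' \<in> {0..T}" "dist s' s < d" for s'
      proof -
        have "\<bar>\<Gamma> s' - \<Gamma> s\<bar> / \<alpha> < e"
          using d(2)[OF that] \<alpha> by (simp add: dist_real_def pos_divide_less_eq mult.commute)
        then show ?thesis using Lip[OF s that(1)] by (simp add: dist_real_def)
      qed
      then show "\<exists>d>0. \<forall>x'\<in>{0..T}. dist x' s < d \<longrightarrow> dist (K x') (K s) < e"
        using d(1) by blast
    qed
  qed
  define E where "E s = exp (K s)" for s
  have cont_E: "continuous_on {0..T} E" unfolding E_def by (intro continuous_intros cont_K)
  \<comment> \<open>In the discrete product rule, \<open>E v * Y v - E u * Y u\<close> is
    \<open>E u * (Y v - Y u)\<close> plus \<open>Y v * (E v - E u)\<close>. The last term is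
    compared with \<open>E u * (\<Gamma> v - \<Gamma> u)\<close>, to which it corresponds formally
    because \<open>dE = E dK\<close> and \<open>dK = d\<Gamma> / Y\<close>.\<close>
  define m where "m u v = Y v * (E v - E u) - E u * (\<Gamma> v - \<Gamma> u)" for u v
  \<comment> \<open>\<open>\<beta> / \<alpha>\<close> pays for linearizing the exponential, using
    \<open>dK \<le> d\<Gamma> / \<alpha>\<close>; \<open>exp (K T) * \<beta>\<close> pays for
    replacing \<open>dK\<close> by \<open>d\<Gamma> / Y v\<close>.\<close>
  define C where "C = \<beta> / \<alpha> + exp (K T) * \<beta>"
  have C: "0 < C" using \<alpha> \<beta> by (simp add: C_def add_pos_pos)
  have "integrator m (\<lambda>_. 0)"
  proof (rule integrator_perturb)
    show "integrator (\<lambda>_ _. 0) (\<lambda>_. 0)"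
      by (simp add: integrator_def bounded_sums_zero sum_upto_def)
    show "bounded_sums (\<lambda>u v. C * (\<Gamma> v - \<Gamma> u))"
    proof (rule bounded_sums_cmult)
      have "sum_upto (P n) s (\<lambda>u v. \<Gamma> v - \<Gamma> u) \<le> \<Gamma> T" if "s \<in> {0..T}" for n s
        using that \<Gamma>_le[of s T] by (simp add: sum_upto_telescope[OF partition_of_P that] \<Gamma>_0)
      then show "bounded_sums (\<lambda>u v. \<Gamma> v - \<Gamma> u)"
        unfolding bounded_sums_def by (intro exI always_eventually) blast
    qed (use C in simp)
    show "m u u = 0" for u by (simp add: m_def)
    fix \<epsilon> :: real assume \<epsilon>: "0 < \<epsilon>"
    have "uniformly_continuous_on {0..T} (\<lambda>s. 1 / Y s)" "uniformly_continuous_on {0..T} E"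
      using cont_inv cont_E by (auto intro: compact_uniformly_continuous)
    then obtain \<delta>1 \<delta>2 where \<delta>: "\<delta>1 > 0" "\<delta>2 > 0"
        "\<And>u v. u \<in> {0..T} \<Longrightarrow> v \<in> {0..T} \<Longrightarrow> dist v u < \<delta>1 \<Longrightarrow> dist (1 / Y v) (1 / Y u) < \<epsilon>"
        "\<And>u v. u \<in> {0..T} \<Longrightarrow> v \<in> {0..T} \<Longrightarrow> dist v u < \<delta>2 \<Longrightarrow> dist (E v) (E u) < \<epsilon>"
      using \<epsilon> unfolding uniformly_continuous_on_def by metis
    have "\<bar>m u v\<bar> \<le> \<epsilon> * (C * (\<Gamma> v - \<Gamma> u))"
      if u: "u \<in> {0..T}" and v: "v \<in> {u..T}" and uv: "v - u < min \<delta>1 \<delta>2" for u v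
    proof -
      define dK d\<Gamma> where "dK = K v - K u" and "d\<Gamma> = \<Gamma> v - \<Gamma> u"
      have r: "0 \<le> u" "u \<le> v" "v \<le> T" using u v by auto
      have v': "v \<in> {0..T}" using r by auto
      have d: "0 \<le> d\<Gamma>" "0 \<le> dK" "dK \<le> d\<Gamma> / \<alpha>"
        using \<Gamma>_le[OF r] K_le[OF r] K_upper[OF r] by (auto simp: d\<Gamma>_def dK_def)
      have near: "\<bar>1 / Y s - 1 / Y v\<bar> \<le> \<epsilon>" if "s \<in> {u..v}" for s
        using \<delta>(3)[OF v', of s] that r uv by (auto simp: dist_real_def)
      have "(1 / Y v - \<epsilon>) * d\<Gamma> \<le> dK" "dK \<le> (1 / Y v + \<epsilon>) * d\<Gamma>"
        unfolding dK_def d\<Gamma>_def using near by (intro incr[OF r]; fastforce simp: abs_le_iff)+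
      then have "\<bar>dK - d\<Gamma> / Y v\<bar> \<le> \<epsilon> * d\<Gamma>" by (simp add: abs_le_iff algebra_simps)
      then have "Y v * \<bar>dK - d\<Gamma> / Y v\<bar> \<le> \<beta> * (\<epsilon> * d\<Gamma>)"
        using bounds[OF v'] Y_pos[OF v'] by (intro mult_mono) auto
      moreover have "Y v * \<bar>dK - d\<Gamma> / Y v\<bar> = \<bar>Y v * (dK - d\<Gamma> / Y v)\<bar>"
        using Y_pos[OF v'] by (simp add: abs_mult)
      moreover have "Y v * (dK - d\<Gamma> / Y v) = Y v * dK - d\<Gamma>"
        using Y_pos[OF v'] by (simp add: right_diff_distrib)
      ultimately have 1: "\<bar>Y v * dK - d\<Gamma>\<bar> \<le> \<beta> * (\<epsilon> * d\<Gamma>)" by simp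
      have Ev: "E v = E u * exp dK" "E u = E v * exp (- dK)"
        by (simp_all add: E_def dK_def exp_diff exp_minus)
      have E_pos: "0 < E s" for s by (simp add: E_def)
      \<comment> \<open>The inequality \<open>exp y \<ge> 1 + y\<close> is used from
        \<open>u\<close> with \<open>dK\<close> and from \<open>v\<close> with \<open>- dK\<close>;
        the two trap the linearization error between \<open>0\<close> and
        \<open>(E v - E u) * dK\<close>.\<close>
      have "E u * (1 + dK) \<le> E v"
        unfolding Ev(1) using E_pos[of u] by (intro mult_left_mono) (auto simp: exp_ge_add_one_self)
      moreover have "E v * (1 + - dK) \<le> E u"
        unfolding Ev(2) using E_pos[of v] by (intro mult_left_mono exp_ge_add_one_self) auto
      ultimately have 2: "0 \<le> E v - E u - E u * dK" "E v - E u - E u * dK \<le> (E v - E u) * dK"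
        by (simp_all add: algebra_simps)
      have "E v - E u \<le> \<epsilon>"
        using \<delta>(4)[OF u v'] uv r by (auto simp: dist_real_def)
      then have "(E v - E u) * dK \<le> \<epsilon> * (d\<Gamma> / \<alpha>)"
        using d \<epsilon> by (intro mult_mono) auto
      then have "Y v * (E v - E u - E u * dK) \<le> \<beta> * (\<epsilon> * (d\<Gamma> / \<alpha>))"
        using 2 bounds[OF v'] \<beta> by (intro mult_mono) auto
      moreover have "0 \<le> Y v * (E v - E u - E u * dK)" using 2 Y_pos[OF v'] by simp
      moreover have "\<bar>E u * (Y v * dK - d\<Gamma>)\<bar> \<le> exp (K T) * (\<beta> * (\<epsilon> * d\<Gamma>))"
      proof -
        have "E u \<le> exp (K T)" using K_le[of u T] r by (simp add: E_def)
        then show ?thesis using 1 E_pos[of u] unfolding abs_mult by (intro mult_mono) auto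
      qed
      moreover have "m u v = Y v * (E v - E u - E u * dK) + E u * (Y v * dK - d\<Gamma>)"
        by (simp add: m_def d\<Gamma>_def algebra_simps)
      ultimately have "\<bar>m u v\<bar> \<le> \<beta> * (\<epsilon> * (d\<Gamma> / \<alpha>)) + exp (K T) * (\<beta> * (\<epsilon> * d\<Gamma>))"
        by linarith
      also have "\<dots> = \<epsilon> * (C * d\<Gamma>)" by (simp add: C_def field_simps)
      finally show ?thesis by (simp add: d\<Gamma>_def)
    qed
    then show "\<exists>\<delta>>0. \<forall>u\<in>{0..T}. \<forall>v\<in>{u..T}. v - u < \<delta> \<longrightarrow> \<bar>m u v - 0\<bar> \<le> \<epsilon> * (C * (\<Gamma> v - \<Gamma> u))"
      using \<delta>(1,2) by (intro exI[of _ "min \<delta>1 \<delta>2"]) auto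
  qed
  note m_lim = integratorD(3)[OF this t]
  \<comment> \<open>Increments of \<open>R\<close> and the discrete remainder, both weighted by
    \<open>E u\<close>, have the same limit \<open>J\<close>. Hence \<Gamma>, which is
    \<open>- R\<close>, can replace the remainder in the sums.\<close>
  obtain J where J: "integrator (\<lambda>u v. E u * remainder G x A u v) J"
      "\<And>t. t \<in> {0..T} \<Longrightarrow> (\<lambda>n. sum_upto (P n) t (\<lambda>u v. E u * (R v - R u))) \<longlonglongrightarrow> J t"
    by (rule integrator_mult[OF R cont_E]) blast
  have "sum_upto (P n) t (\<lambda>u v. \<Sum>i\<in>UNIV. multiplicative_integrand P G x A u $ i * (x v $ i - x u $ i)) =
      (E t * Y t - E 0 * Y 0) - sum_upto (P n) t m + sum_upto (P n) t (\<lambda>u v. E u * (R v - R u)) -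
      sum_upto (P n) t (\<lambda>u v. E u * remainder G x A u v)" for n
  proof -
    have "(\<Sum>i\<in>UNIV. multiplicative_integrand P G x A u $ i * (x v $ i - x u $ i)) =
        (E v * Y v - E u * Y u) - m u v + E u * (R v - R u) - E u * remainder G x A u v"
      if uv: "u \<in> {0..T}" "v \<in> {0..T}" for u v
    proof -
      have "(\<Sum>i\<in>UNIV. multiplicative_integrand P G x A u $ i * (x v $ i - x u $ i)) =
          E u * (\<Sum>i\<in>UNIV. grad1 G (x u, A u) $ i * (x v $ i - x u $ i))"
        by (simp add: multiplicative_integrand_def E_def K_def Y_def \<Gamma>_def sum_distrib_left mult.commute mult.left_commute)
      then show ?thesis
        unfolding YY by (simp add: m_def \<Gamma>R[OF uv(1)] \<Gamma>R[OF uv(2)] algebra_simps)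
    qed
    then have "sum_upto (P n) t (\<lambda>u v. \<Sum>i\<in>UNIV. multiplicative_integrand P G x A u $ i * (x v $ i - x u $ i)) =
        sum_upto (P n) t (\<lambda>u v. (E v * Y v - E u * Y u) - m u v + E u * (R v - R u) - E u * remainder G x A u v)"
      by (rule sum_upto_cong[OF partition_of_P t])
    then show ?thesis
      unfolding sum_upto_diff[where g = "\<lambda>u v. E u * remainder G x A u v"] sum_upto_add
        sum_upto_diff[where g = m] sum_upto_telescope[OF partition_of_P t, where h = "\<lambda>s. E s * Y s"] .
  qed
  moreover have "(\<lambda>n. (E t * Y t - E 0 * Y 0) - sum_upto (P n) t m + sum_upto (P n) t (\<lambda>u v. E u * (R v - R u)) -
      sum_upto (P n) t (\<lambda>u v. E u * remainder G x A u v)) \<longlonglongrightarrow> (E t * Y t - E 0 * Y 0) - 0 + J t - J t"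
    by (intro tendsto_intros m_lim J(2)[OF t] integratorD(3)[OF J(1) t])
  ultimately show "foellmer_integral P (multiplicative_integrand P G x A) x t = Y t * exp (K t) - Y 0"
    unfolding foellmer_integral_def by (intro limI) (simp add: E_def K_0 mult.commute)
qed

end

section \<open>Market weights and relative arbitrage\<close>

lemma market_weights_continuous:
  assumes "market_prices T S"
  shows "continuous_on {0..T} (market_weights S)"
  using assms unfolding market_prices_def market_weights_def
  by (intro continuous_on_vec_lambda continuous_intros) force+

lemma market_weights_sum:
  assumes "market_prices T S" "t \<in> {0..T}"
  shows "(\<Sum>i\<in>UNIV. market_weights S t $ i) = 1"
  using assms by (force simp: market_weights_def market_prices_def sum_divide_distrib[symmetric])

theorem theorem4p7:
  fixes T Tstar \<alpha> \<beta> :: real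
    and P :: "nat \<Rightarrow> real set"
    and S \<mu> :: "real \<Rightarrow> real ^ 'd"
    and A :: "real \<Rightarrow> real ^ 'm"
    and G :: "(real ^ 'd) \<times> (real ^ 'm) \<Rightarrow> real"
  assumes "0 < T"
    and "refining_partitions T P"
    and "CARD('d) \<ge> 2"
    and "market_prices T S"
    and "\<mu> = market_weights S"
    and "has_quadratic_covariations T P \<mu>"
    and "CBV T A"
    and "\<forall>z. G z > 0"
    and "regular T P G \<mu> A"
    and "G (\<mu> 0, A 0) = 1"
    and "0 < \<alpha>" and "0 < \<beta>"
    and "\<forall>t\<in>{0..T}. \<alpha> \<le> G (\<mu> t, A t) \<and> G (\<mu> t, A t) \<le> \<beta>"
    and "mono_on {0..T} (Gamma_process P G \<mu> A)"
    and "0 < Tstar" and "Tstar \<le> T"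
    and "Gamma_process P G \<mu> A Tstar > \<beta> * ln (1 / \<alpha>)"
  shows "\<forall>t\<in>{Tstar..T}. strong_relative_arbitrage \<mu> (multiplicatively_generated P G \<mu> A) t"
proof -
  interpret partition_sequence T P by standard fact+
  define \<Gamma> where "\<Gamma> = Gamma_process P G \<mu> A"
  define K where "K t = stieltjes_integral 0 t (\<lambda>s. 1 / G (\<mu> s, A s)) \<Gamma>" for t
  define \<psi> where "\<psi> = multiplicatively_generated P G \<mu> A"
  have x: "continuous_on {0..T} \<mu>"
    unfolding \<open>\<mu> = market_weights S\<close> by (rule market_weights_continuous) fact
  have G: "C21 G" using \<open>regular T P G \<mu> A\<close> by (simp add: regular_def)
  have integral: "foellmer_integral P (multiplicative_integrand P G \<mu> A) \<mu> t = G (\<mu> t, A t) * exp (K t) - 1"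
    and K: "\<Gamma> t / \<beta> \<le> K t" if "t \<in> {0..T}" for t
    using foellmer_integral_multiplicative[OF G x, of A \<alpha> \<beta> t] that assms
    by (auto simp: K_def \<Gamma>_def)
  \<comment> \<open>As the weights sum to one, subtracting one scalar from all components lowers the
    value by that scalar. The initial value of the integrand cancels against the constant
    \<open>C0\<close>, the exponential being \<open>1\<close> at time zero.\<close>
  have psi_value: "portfolio_value \<mu> \<psi> t = G (\<mu> t, A t) * exp (K t)" if t: "t \<in> {0..T}" for t
  proof -
    let ?\<eta> = "multiplicative_integrand P G \<mu> A"
    have sum1: "(\<Sum>i\<in>UNIV. \<mu> t $ i) = 1"
      unfolding \<open>\<mu> = market_weights S\<close> using market_weights_sum t assms by blast
    let ?c = "self_financing_defect P \<mu> ?\<eta> t + ((\<Sum>i\<in>UNIV. grad1 G (\<mu> 0, A 0) $ i * \<mu> 0 $ i) - 1)"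
    have "portfolio_value \<mu> \<psi> t = (\<Sum>i\<in>UNIV. ?\<eta> t $ i * \<mu> t $ i - ?c * \<mu> t $ i)"
      using \<open>G (\<mu> 0, A 0) = 1\<close>
      by (simp add: portfolio_value_def \<psi>_def multiplicatively_generated_def Let_def algebra_simps)
    also have "\<dots> = portfolio_value \<mu> ?\<eta> t - ?c"
      by (simp add: sum_subtractf sum_distrib_left[symmetric] sum1 portfolio_value_def)
    also have "\<dots> = portfolio_value \<mu> ?\<eta> 0 + foellmer_integral P ?\<eta> \<mu> t -
        ((\<Sum>i\<in>UNIV. grad1 G (\<mu> 0, A 0) $ i * \<mu> 0 $ i) - 1)"
      by (simp add: self_financing_defect_def)
    also have "portfolio_value \<mu> ?\<eta> 0 = (\<Sum>i\<in>UNIV. grad1 G (\<mu> 0, A 0) $ i * \<mu> 0 $ i)"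
      by (simp add: portfolio_value_def multiplicative_integrand_def)
    finally show ?thesis by (simp add: integral[OF t])
  qed
  show ?thesis
    unfolding strong_relative_arbitrage_def \<psi>_def[symmetric]
  proof (intro ballI conjI)
    fix t s assume "t \<in> {Tstar..T}" "s \<in> {0..t}"
    then have "s \<in> {0..T}" by auto
    then show "0 \<le> portfolio_value \<mu> \<psi> s"
      using \<open>\<forall>z. G z > 0\<close> by (simp add: psi_value less_imp_le)
  next
    fix t assume "t \<in> {Tstar..T}"
    then have t: "t \<in> {0..T}" "Tstar \<le> t" using \<open>0 < Tstar\<close> by auto
    \<comment> \<open>Monotonicity carries the threshold to every later horizon; division by \<beta>
      turns it into a lower bound for \<open>K t\<close>.\<close>
    have "\<Gamma> Tstar \<le> \<Gamma> t"
      unfolding \<Gamma>_def using t \<open>0 < Tstar\<close> \<open>Tstar \<le> T\<close>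
      by (intro mono_onD[OF \<open>mono_on {0..T} (Gamma_process P G \<mu> A)\<close>]) auto
    then have "\<beta> * ln (1 / \<alpha>) < \<Gamma> t"
      using assms(17) by (simp add: \<Gamma>_def)
    then have "ln (1 / \<alpha>) < \<Gamma> t / \<beta>"
      using \<open>0 < \<beta>\<close> by (simp add: pos_less_divide_eq mult.commute)
    then have "ln (1 / \<alpha>) < K t" using K[OF t(1)] by linarith
    then have "1 / \<alpha> < exp (K t)"
      using \<open>0 < \<alpha>\<close> by (metis exp_less_cancel_iff exp_ln zero_less_divide_1_iff)
    \<comment> \<open>The exponential factor outweighs even the lowest level \<alpha> allowed for
      \<open>G\<close> along the path.\<close>
    then have "1 < \<alpha> * exp (K t)"
      using \<open>0 < \<alpha>\<close> by (simp add: pos_divide_less_eq mult.commute)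
    also have "\<dots> \<le> G (\<mu> t, A t) * exp (K t)"
      using assms(13) t by (intro mult_right_mono) auto
    finally have "1 < portfolio_value \<mu> \<psi> t" by (simp add: psi_value[OF t(1)])
    moreover have "portfolio_value \<mu> \<psi> 0 = 1"
      using psi_value[of 0] \<open>0 < T\<close> \<open>G (\<mu> 0, A 0) = 1\<close> by (simp add: K_def)
    ultimately show "portfolio_value \<mu> \<psi> 0 < portfolio_value \<mu> \<psi> t" by simp
  qed
qed

end
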